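(* For every $1<p<\infty$ there exists a Schauder basic sequence $(z_j)_{j=0}^\infty$ in $L_p(\mathbb{R})$ consisting of non-negative functions such that $L_p(\mathbb{R})$ is isomorphic to a subspace of the closed linear span of $(z_j)_{j=0}^\infty$.
   Context: A sequence in a Banach space is a Schauder basic sequence if it is a Schauder basis of its closed linear span. "Isomorphic" means linearly isomorphic as Banach spaces (bounded linear bijection with bounded inverse). Non-negative means $\ge0$ almost everywhere. *)

theory Defs
  imports "HOL-Analysis.Analysis"
begin

text \<open>L_p(R): Borel measurable real functions f with |f|^p Lebesgue integrable.
  Elements are functions; equality in L_p is a.e. equality, which is
  automatically respected since everything is expressed via the L_p seminorm.\<close>

definition Lp :: "real \<Rightarrow> (real \<Rightarrow> real) set" where
  "Lp p = {f. f \<in> borel_measurable lborel \<and> integrable lborel (\<lambda>x. \<bar>f x\<bar> powr p)}"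

definition Lp_norm :: "real \<Rightarrow> (real \<Rightarrow> real) \<Rightarrow> real" where
  "Lp_norm p f = (\<integral>x. \<bar>f x\<bar> powr p \<partial>lborel) powr (1 / p)"

definition closed_span :: "real \<Rightarrow> (nat \<Rightarrow> real \<Rightarrow> real) \<Rightarrow> (real \<Rightarrow> real) set" where
  "closed_span p z = {f \<in> Lp p. \<forall>e>0. \<exists>n c.
      Lp_norm p (\<lambda>x. f x - (\<Sum>j<n. c j * z j x)) < e}"

definition schauder_basic :: "real \<Rightarrow> (nat \<Rightarrow> real \<Rightarrow> real) \<Rightarrow> bool" where
  "schauder_basic p z \<longleftrightarrow> (\<forall>j. z j \<in> Lp p) \<and>
     (\<forall>f \<in> closed_span p z. \<exists>!c::nat \<Rightarrow> real.
        (\<lambda>n. Lp_norm p (\<lambda>x. f x - (\<Sum>j<n. c j * z j x))) \<longlonglongrightarrow> 0)"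

definition Lp_embeds_into :: "real \<Rightarrow> (real \<Rightarrow> real) set \<Rightarrow> bool" where
  "Lp_embeds_into p S \<longleftrightarrow> (\<exists>T :: (real \<Rightarrow> real) \<Rightarrow> (real \<Rightarrow> real). \<exists>c C.
      c > 0 \<and> (\<forall>f \<in> Lp p. T f \<in> S) \<and>
      (\<forall>f \<in> Lp p. \<forall>g \<in> Lp p. \<forall>a b. T (\<lambda>x. a * f x + b * g x) = (\<lambda>x. a * T f x + b * T g x)) \<and>
      (\<forall>f \<in> Lp p. c * Lp_norm p f \<le> Lp_norm p (T f) \<and> Lp_norm p (T f) \<le> C * Lp_norm p f))"

end

theory Submission
  imports Defs "HOL-Library.Discrete_Functions"
begin

text \<open>
  Let \<open>h\<^sub>j\<close> be the normalised Haar basis of \<open>L\<^sub>p(0,1)\<close>. Each \<open>h\<^sub>j\<close> is written as an alternating sum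
  of a long block of non-negative functions
  \<open>z\<^sub>i = x\<^sub>i + (\<bar>h\<^sub>j - v\<^sub>j\<bar> + (- 1)\<^sup>i (h\<^sub>j - v\<^sub>j)) / N\<close> for \<open>i < N = 2\<^sup>R\<close>, where the tags \<open>x\<^sub>i \<ge> 0\<close> live
  outside the unit interval and \<open>v\<^sub>j = \<Sum>\<^sub>i (- 1)\<^sup>i x\<^sub>i\<close>. The difficulty is that the sequence \<open>\<bar>h\<^sub>j\<bar>\<close> is not basic. The tags
  have to see the plain average of the coefficients strongly, so that the contribution of \<open>\<bar>h\<^sub>j - v\<^sub>j\<bar>\<close> is
  a small perturbation, but must be cheap on alternating coefficients, and they must form a basic
  sequence with a constant independent of \<open>R\<close>. This is achieved by the norm that adds up the \<open>p\<close>-th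
  powers of the \<open>L\<^sub>p\<close> norms of the conditional expectations of the coefficient sequence onto the
  dyadic partitions of all \<open>R + 1\<close> scales: it is at least \<open>(R + 1)\<^sup>1\<^sup>/\<^sup>p\<close> times the average, while an
  alternating sequence is seen at the finest scale only.
\<close>

section \<open>The space \<open>L\<^sub>p\<close>\<close>

text \<open>Subtracting \<open>v_j\<close> inside a block makes its alternating sum equal to
  \<open>h_j\<close> exactly, so the Haar functions lie in the span without any approximation. For
  general coefficients a block sum splits into (alternating average) times \<open>h_j\<close>, a tag
  vector without alternating component, and (plain average) times \<open>|h_j - v_j|\<close>. Over
  all blocks the first two kinds form a main part: they live on disjoint sets, the Haar basis is
  monotone, and tags of different blocks are disjoint. The third kind has no structure and must be
  small. The plain average is at most \<open>(R_j + 1) powr (- 1 / p)\<close> times the tag norm,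
  and once this factor is at most \<open>1 / 2 ^ (j + 3)\<close> all perturbations together are at
  most half of the main part. What remains is a partial sum that ends inside a block: cutting an
  alternating sequence may destroy its cancellation at all coarser scales at once, and the energy
  must grow by no more than a constant factor.\<close>

lemma convex_on_powr_nonneg:
  fixes p :: real
  assumes "1 \<le> p"
  shows "convex_on {0..} (\<lambda>x. x powr p)"
proof (rule convex_onI)
  fix t x y :: real
  assume t: "0 < t" "t < 1" and xy: "x \<in> {0..}" "y \<in> {0..}"
  \<comment> \<open>If one of the two points is 0, convexity reduces to
    \<open>s powr p \<le> s\<close> for 0 < s < 1; positive points are covered by
    \<open>powr_convex\<close>.\<close>
  have scale: "(s * u) powr p \<le> s * u powr p" if "0 < s" "s < 1" "0 \<le> u" for s u :: real
  proof -
    have "s powr p \<le> s powr 1"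
      using that assms by (intro powr_mono') auto
    then show ?thesis
      using that by (simp add: powr_mult mult_right_mono)
  qed
  show "((1 - t) *\<^sub>R x + t *\<^sub>R y) powr p \<le> (1 - t) * x powr p + t * y powr p"
  proof (cases "x = 0 \<or> y = 0")
    case True
    then show ?thesis
      using scale[of t y] scale[of "1 - t" x] t xy by auto
  next
    case False
    then show ?thesis
      using convex_onD[OF powr_convex[OF assms], of t x y] t xy by simp
  qed
qed simp

text \<open>Jensen's inequality with uniform weights, the source of every comparison between an
  average and the energy below.\<close>

lemma powr_average_le:
  fixes a :: "'i \<Rightarrow> real" and p :: real
  assumes "1 \<le> p" "finite S" "S \<noteq> {}"
  shows "((\<Sum>i\<in>S. \<bar>a i\<bar>) / card S) powr p \<le> (\<Sum>i\<in>S. \<bar>a i\<bar> powr p) / card S"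
proof -
  have "card S > 0"
    using assms by (simp add: card_gt_0_iff)
  then have "(\<Sum>i\<in>S. (1 / real (card S)) *\<^sub>R \<bar>a i\<bar>) powr p
      \<le> (\<Sum>i\<in>S. (1 / real (card S)) * \<bar>a i\<bar> powr p)"
    using convex_on_sum[OF assms(2,3) convex_on_powr_nonneg[OF assms(1)], of "\<lambda>i. 1 / real (card S)" "\<lambda>i. \<bar>a i\<bar>"]
    by simp
  then show ?thesis
    by (simp add: sum_divide_distrib)
qed

locale lp_space =
  fixes p :: real
  assumes p_gt_1: "1 < p"
begin

abbreviation nrm :: "(real \<Rightarrow> real) \<Rightarrow> real" where
  "nrm \<equiv> Lp_norm p"

lemma Lp_measurable [measurable_dest]: "f \<in> Lp p \<Longrightarrow> f \<in> borel_measurable borel"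
  by (simp add: Lp_def)

lemma Lp_integrable: "f \<in> Lp p \<Longrightarrow> integrable lborel (\<lambda>x. \<bar>f x\<bar> powr p)"
  by (simp add: Lp_def)

lemma LpI:
  "f \<in> borel_measurable borel \<Longrightarrow> integrable lborel (\<lambda>x. \<bar>f x\<bar> powr p) \<Longrightarrow> f \<in> Lp p"
  by (simp add: Lp_def)

lemma nrm_nonneg [simp]: "0 \<le> nrm f"
  by (simp add: Lp_norm_def)

lemma nrm_powr: "nrm f powr p = (\<integral>x. \<bar>f x\<bar> powr p \<partial>lborel)"
  using p_gt_1 by (simp add: Lp_norm_def powr_powr integral_nonneg_AE)

lemma le_if_powr_le:
  fixes a b :: real
  assumes "a powr p \<le> b powr p" "0 \<le> a" "0 \<le> b"
  shows "a \<le> b"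
  using assms p_gt_1 powr_mono2[of "1 / p" "a powr p" "b powr p"] by (simp add: powr_powr)

lemma Lp_bound:
  assumes "f \<in> Lp p" "g \<in> borel_measurable borel" "\<And>x. \<bar>g x\<bar> \<le> \<bar>f x\<bar>"
  shows "g \<in> Lp p"
proof (rule LpI)
  show "integrable lborel (\<lambda>x. \<bar>g x\<bar> powr p)"
  proof (rule Bochner_Integration.integrable_bound[OF Lp_integrable[OF assms(1)]])
    show "AE x in lborel. norm (\<bar>g x\<bar> powr p) \<le> norm (\<bar>f x\<bar> powr p)"
      using assms(3) p_gt_1 by (auto intro!: powr_mono2)
  qed (use assms(2) in measurable)
qed (use assms in auto)

lemma nrm_mono:
  assumes "f \<in> Lp p" "g \<in> borel_measurable borel" "\<And>x. \<bar>g x\<bar> \<le> \<bar>f x\<bar>"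
  shows "nrm g \<le> nrm f"
proof (rule le_if_powr_le)
  show "nrm g powr p \<le> nrm f powr p"
    unfolding nrm_powr
    using Lp_integrable[OF Lp_bound[OF assms]] Lp_integrable[OF assms(1)] assms(3) p_gt_1
    by (intro integral_mono) (auto intro!: powr_mono2)
qed auto

lemma Lp_zero [simp]: "(\<lambda>x. 0) \<in> Lp p"
  using p_gt_1 by (intro LpI) auto

lemma nrm_zero [simp]: "nrm (\<lambda>x. 0) = 0"
  using p_gt_1 by (simp add: Lp_norm_def)

lemma Lp_scale [intro]:
  assumes "f \<in> Lp p" shows "(\<lambda>x. a * f x) \<in> Lp p"
  using assms Lp_integrable[OF assms]
  by (intro LpI) (auto simp: abs_mult powr_mult dest: Lp_measurable)

lemma nrm_scale [simp]: "nrm (\<lambda>x. a * f x) = \<bar>a\<bar> * nrm f"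
  using p_gt_1
  by (simp add: Lp_norm_def abs_mult powr_mult powr_powr integral_nonneg_AE)

lemma nrm_uminus [simp]: "nrm (\<lambda>x. - f x) = nrm f"
  by (simp add: Lp_norm_def)

lemma nrm_minus_commute: "nrm (\<lambda>x. f x - g x) = nrm (\<lambda>x. g x - f x)"
  by (simp add: Lp_norm_def abs_minus_commute)

lemma nrm_abs [simp]: "nrm (\<lambda>x. \<bar>f x\<bar>) = nrm f"
  by (simp add: Lp_norm_def)

text \<open>Minkowski's inequality is convexity of \<open>t powr p\<close> applied to the normalised functions
  \<open>f / \<alpha>\<close> and \<open>g / \<beta>\<close>.\<close>

lemma powr_add_le:
  fixes u v \<alpha> \<beta> :: real
  assumes "0 < \<alpha>" "0 < \<beta>"
  shows "\<bar>u + v\<bar> powr p \<le> (\<alpha> + \<beta>) powr p *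
    (\<alpha> / (\<alpha> + \<beta>) * (\<bar>u\<bar> powr p / \<alpha> powr p) + \<beta> / (\<alpha> + \<beta>) * (\<bar>v\<bar> powr p / \<beta> powr p))"
proof -
  define t where "t = \<beta> / (\<alpha> + \<beta>)"
  have t: "0 \<le> t" "t \<le> 1" "1 - t = \<alpha> / (\<alpha> + \<beta>)"
    using assms by (auto simp: t_def field_simps)
  have "\<bar>u + v\<bar> powr p \<le> (\<bar>u\<bar> + \<bar>v\<bar>) powr p"
    using p_gt_1 by (intro powr_mono2) auto
  also have "\<bar>u\<bar> + \<bar>v\<bar> = (\<alpha> + \<beta>) * ((1 - t) * (\<bar>u\<bar> / \<alpha>) + t * (\<bar>v\<bar> / \<beta>))"
    using assms unfolding t(3) by (simp add: distrib_left t_def)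
  also have "\<dots> powr p = (\<alpha> + \<beta>) powr p * ((1 - t) * (\<bar>u\<bar> / \<alpha>) + t * (\<bar>v\<bar> / \<beta>)) powr p"
    using assms t by (intro powr_mult)
  also have "((1 - t) * (\<bar>u\<bar> / \<alpha>) + t * (\<bar>v\<bar> / \<beta>)) powr p
      \<le> (1 - t) * (\<bar>u\<bar> / \<alpha>) powr p + t * (\<bar>v\<bar> / \<beta>) powr p"
    using convex_onD[OF convex_on_powr_nonneg, of p t "\<bar>u\<bar> / \<alpha>" "\<bar>v\<bar> / \<beta>"] p_gt_1 t assms by simp
  finally show ?thesis
    using assms t by (simp add: powr_divide t_def mult_left_mono)
qed

lemma Lp_add [intro]:
  assumes "f \<in> Lp p" "g \<in> Lp p" shows "(\<lambda>x. f x + g x) \<in> Lp p"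
proof (rule LpI)
  note [measurable] = assms[THEN Lp_measurable]
  show "(\<lambda>x. f x + g x) \<in> borel_measurable borel" by measurable
  show "integrable lborel (\<lambda>x. \<bar>f x + g x\<bar> powr p)"
    \<comment> \<open>With both normalising constants equal to 1 the pointwise bound is an
      integrable majorant.\<close>
    by (rule Bochner_Integration.integrable_bound[where f = "\<lambda>x. (1 + 1) powr p *
        (1 / (1 + 1) * (\<bar>f x\<bar> powr p / 1 powr p) + 1 / (1 + 1) * (\<bar>g x\<bar> powr p / 1 powr p))"])
      (use powr_add_le[of 1 1] Lp_integrable[OF assms(1)] Lp_integrable[OF assms(2)] in \<open>simp_all\<close>)
qed

lemma nrm_triangle:
  assumes "f \<in> Lp p" "g \<in> Lp p"
  shows "nrm (\<lambda>x. f x + g x) \<le> nrm f + nrm g"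
proof (rule field_le_epsilon)
  fix e :: real assume "0 < e"
  \<comment> \<open>The summand \<open>e / 2\<close> keeps the normalising constants positive even
    when a norm vanishes.\<close>
  define \<alpha> \<beta> where "\<alpha> = nrm f + e / 2" and "\<beta> = nrm g + e / 2"
  have pos: "0 < \<alpha>" "0 < \<beta>"
    using \<open>0 < e\<close> by (auto simp: \<alpha>_def \<beta>_def intro: add_nonneg_pos)
  have le1: "nrm f powr p / \<alpha> powr p \<le> 1" "nrm g powr p / \<beta> powr p \<le> 1"
    using pos \<open>0 < e\<close> p_gt_1 by (auto simp: \<alpha>_def \<beta>_def intro!: powr_mono2)
  note int = Lp_integrable[OF assms(1)] Lp_integrable[OF assms(2)]
  have "nrm (\<lambda>x. f x + g x) powr p \<le> (\<integral>x. (\<alpha> + \<beta>) powr p *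
    (\<alpha> / (\<alpha> + \<beta>) * (\<bar>f x\<bar> powr p / \<alpha> powr p) + \<beta> / (\<alpha> + \<beta>) * (\<bar>g x\<bar> powr p / \<beta> powr p)) \<partial>lborel)"
    unfolding nrm_powr
    using Lp_integrable[OF Lp_add[OF assms]] int powr_add_le[OF pos]
    by (intro integral_mono) auto
  also have "\<dots> = (\<alpha> + \<beta>) powr p *
    (\<alpha> / (\<alpha> + \<beta>) * (nrm f powr p / \<alpha> powr p) + \<beta> / (\<alpha> + \<beta>) * (nrm g powr p / \<beta> powr p))"
    using int by (simp add: nrm_powr)
  also have "\<dots> \<le> (\<alpha> + \<beta>) powr p * (\<alpha> / (\<alpha> + \<beta>) * 1 + \<beta> / (\<alpha> + \<beta>) * 1)"
    using pos le1 by (intro mult_left_mono add_mono) auto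
  also have "\<dots> = (\<alpha> + \<beta>) powr p"
    using pos by (simp flip: add_divide_distrib)
  finally have "nrm (\<lambda>x. f x + g x) \<le> \<alpha> + \<beta>"
    by (rule le_if_powr_le) (use pos in auto)
  then show "nrm (\<lambda>x. f x + g x) \<le> nrm f + nrm g + e"
    by (simp add: \<alpha>_def \<beta>_def)
qed

lemma Lp_minus [intro]: "f \<in> Lp p \<Longrightarrow> g \<in> Lp p \<Longrightarrow> (\<lambda>x. f x - g x) \<in> Lp p"
  using Lp_add[of f "\<lambda>x. -1 * g x"] Lp_scale[of g "-1"] by simp

lemma nrm_triangle_minus:
  "f \<in> Lp p \<Longrightarrow> g \<in> Lp p \<Longrightarrow> nrm (\<lambda>x. f x - g x) \<le> nrm f + nrm g"
  using nrm_triangle[of f "\<lambda>x. -1 * g x"] Lp_scale[of g "-1"] by simp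

lemma nrm_diff_ge:
  assumes "f \<in> Lp p" "g \<in> Lp p" shows "nrm f - nrm g \<le> nrm (\<lambda>x. f x - g x)"
  using nrm_triangle[OF Lp_minus[OF assms] assms(2)] by (simp add: diff_add_cancel)

lemma Lp_abs [intro]: "f \<in> Lp p \<Longrightarrow> (\<lambda>x. \<bar>f x\<bar>) \<in> Lp p"
  by (rule Lp_bound[of f]) (auto dest: Lp_measurable)

lemma Lp_sum [intro]:
  "(\<And>i. i \<in> I \<Longrightarrow> f i \<in> Lp p) \<Longrightarrow> (\<lambda>x. \<Sum>i\<in>I. f i x) \<in> Lp p"
  by (induction I rule: infinite_finite_induct) auto

lemma nrm_sum:
  "(\<And>i. i \<in> I \<Longrightarrow> f i \<in> Lp p) \<Longrightarrow> nrm (\<lambda>x. \<Sum>i\<in>I. f i x) \<le> (\<Sum>i\<in>I. nrm (f i))"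
proof (induction I rule: infinite_finite_induct)
  case (insert i I)
  have "nrm (\<lambda>x. f i x + (\<Sum>i\<in>I. f i x)) \<le> nrm (f i) + nrm (\<lambda>x. \<Sum>i\<in>I. f i x)"
    using insert.prems by (intro nrm_triangle Lp_sum) simp_all
  then show ?case
    using insert.IH[OF insert.prems] insert.hyps by simp
qed auto

text \<open>Dominated convergence for the p-th powers; all three approximation steps in the density
  proof for the Haar functions go through it.\<close>

lemma nrm_lim_dominated:
  assumes "g \<in> Lp p" "f \<in> borel_measurable borel" "\<And>n::nat. s n \<in> borel_measurable borel"
    and lim: "AE x in lborel. (\<lambda>n. s n x) \<longlonglongrightarrow> f x"
    and bd: "\<And>n. AE x in lborel. \<bar>s n x - f x\<bar> \<le> \<bar>g x\<bar>"
  shows "(\<lambda>n. nrm (\<lambda>x. s n x - f x)) \<longlonglongrightarrow> 0"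
proof -
  note [measurable] = assms(2,3)
  have "AE x in lborel. (\<lambda>n. \<bar>s n x - f x\<bar> powr p) \<longlonglongrightarrow> 0"
    using lim
  proof eventually_elim
    case (elim x)
    then have "(\<lambda>n. \<bar>s n x - f x\<bar>) \<longlonglongrightarrow> 0"
      by (simp add: LIM_zero tendsto_rabs_zero)
    then show ?case
      using p_gt_1 by (intro tendsto_zero_powrI[OF _ tendsto_const]) auto
  qed
  moreover have "AE x in lborel. norm (\<bar>s n x - f x\<bar> powr p) \<le> \<bar>g x\<bar> powr p" for n
    using bd[of n] by eventually_elim (use p_gt_1 in \<open>auto intro!: powr_mono2\<close>)
  ultimately have "(\<lambda>n. \<integral>x. \<bar>s n x - f x\<bar> powr p \<partial>lborel) \<longlonglongrightarrow> (\<integral>x. 0 \<partial>(lborel :: real measure))"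
    using Lp_integrable[OF assms(1)]
    by (intro integral_dominated_convergence[where w = "\<lambda>x. \<bar>g x\<bar> powr p"]) simp_all
  then show ?thesis
    unfolding Lp_norm_def using p_gt_1
    by (intro tendsto_zero_powrI[OF _ tendsto_const]) (auto simp: integral_nonneg_AE)
qed

end

section \<open>The dyadic energy of a coefficient sequence\<close>

lemma sum_lessThan_add:
  fixes f :: "nat \<Rightarrow> 'a::comm_monoid_add"
  shows "(\<Sum>i<m + n. f i) = (\<Sum>i<m. f i) + (\<Sum>i<n. f (m + i))"
  by (induction n) (simp_all add: add.assoc)

lemma sum_truncate:
  fixes f :: "nat \<Rightarrow> real"
  assumes "k \<le> n"
  shows "(\<Sum>i<n. if i < k then f i else 0) = (\<Sum>i<k. f i)"
  using assms by (intro sum.mono_neutral_cong_right) auto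

lemma sum_alternating_even:
  fixes n :: nat
  assumes "even n" shows "(\<Sum>i<n. (- 1) ^ i :: real) = 0"
proof -
  have "(\<Sum>i<2 * m. (- 1) ^ i :: real) = 0" for m
    by (induction m) auto
  then show ?thesis using assms by (elim evenE) simp
qed

context lp_space
begin

text \<open>If m is the mean of \<open>b\<close> over a block of length \<open>2 ^ r\<close>, the
  summand is \<open>2 ^ r * \<bar>m\<bar> powr p\<close>. So \<open>energy R b / 2 ^ R\<close> adds
  up, over all scales, the p-th powers of the L_p norms of the conditional expectations for the
  uniform probability on \<open>{..<2 ^ R}\<close>.\<close>

definition energy :: "nat \<Rightarrow> (nat \<Rightarrow> real) \<Rightarrow> real" where
  "energy R b = (\<Sum>r\<le>R. \<Sum>g<2 ^ (R - r). \<bar>\<Sum>i<2 ^ r. b (g * 2 ^ r + i)\<bar> powr p / (2 ^ r) powr (p - 1))"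

lemma energy_zero [simp]: "energy R (\<lambda>i. 0) = 0"
  using p_gt_1 by (simp add: energy_def)

lemma energy_0: "energy 0 b = \<bar>b 0\<bar> powr p"
  by (simp add: energy_def)

text \<open>Only the single block of the coarsest scale meets both halves; this recursion drives the
  truncation estimate.\<close>

lemma energy_Suc:
  "energy (Suc R) b = energy R b + energy R (\<lambda>i. b (2 ^ R + i))
     + \<bar>\<Sum>i<2 ^ Suc R. b i\<bar> powr p / (2 ^ Suc R) powr (p - 1)"
proof -
  define f where "f r g b = \<bar>\<Sum>i<2 ^ r. b (g * 2 ^ r + i)\<bar> powr p / (2 ^ r) powr (p - 1)"
    for r g :: nat and b :: "nat \<Rightarrow> real"
  have "(\<Sum>g<2 ^ (Suc R - r). f r g b) = (\<Sum>g<2 ^ (R - r). f r g b) + (\<Sum>g<2 ^ (R - r). f r g (\<lambda>i. b (2 ^ R + i)))"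
    if "r \<le> R" for r
  proof -
    have "(2::nat) ^ (R - r) * 2 ^ r = 2 ^ R"
      using that by (simp flip: power_add)
    then have "(2 ^ (R - r) + g) * 2 ^ r + i = 2 ^ R + (g * 2 ^ r + i)" for g i :: nat
      by (simp add: distrib_right)
    then have "f r (2 ^ (R - r) + g) b = f r g (\<lambda>i. b (2 ^ R + i))" for g
      by (simp add: f_def add.assoc)
    moreover have "(2::nat) ^ (Suc R - r) = 2 ^ (R - r) + 2 ^ (R - r)"
      using that by (simp add: Suc_diff_le)
    ultimately show ?thesis
      by (simp add: sum_lessThan_add)
  qed
  then show ?thesis
    unfolding energy_def by (simp flip: f_def add: sum.distrib) (simp add: f_def)
qed

lemma energy_term_nonneg: "0 \<le> \<bar>x\<bar> powr p / (2 ^ r) powr (p - 1)"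
  by simp

text \<open>The left side is the contribution of scale 0, and the other scales are
  non-negative.\<close>

lemma sum_powr_le_energy: "(\<Sum>i<2 ^ R. \<bar>b i\<bar> powr p) \<le> energy R b"
proof -
  have "energy R b = (\<Sum>r\<in>insert 0 {1..R}. \<Sum>g<2 ^ (R - r). \<bar>\<Sum>i<2 ^ r. b (g * 2 ^ r + i)\<bar> powr p / (2 ^ r) powr (p - 1))"
    unfolding energy_def by (rule sum.cong) auto
  also have "\<dots> \<ge> (\<Sum>i<2 ^ R. \<bar>b i\<bar> powr p)"
    by (subst sum.insert) (auto intro!: sum_nonneg)
  finally show ?thesis .
qed

lemma energy_nonneg: "0 \<le> energy R b"
  unfolding energy_def by (intro sum_nonneg energy_term_nonneg)

lemma powr_sum_le:
    fixes b :: "nat \<Rightarrow> real"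
  shows "(\<Sum>i<2 ^ R. \<bar>b i\<bar>) powr p / (2 ^ R) powr (p - 1) \<le> (\<Sum>i<2 ^ R. \<bar>b i\<bar> powr p)"
  using powr_average_le[of p "{..<2 ^ R :: nat}" b] p_gt_1
  by (simp add: powr_divide powr_diff field_simps sum_nonneg lessThan_empty_iff)

text \<open>Doubling the block length divides by \<open>2 powr (p - 1) > 1\<close>. This leaves room
  for a factor below 1 in front of \<open>u powr p\<close>, which is the contraction behind a Hardy
  inequality.\<close>

lemma powr_add_halved:
  obtains \<theta> C :: real where "0 < \<theta>" "\<theta> < 1" "0 \<le> C"
    "\<And>u v. 0 \<le> u \<Longrightarrow> 0 \<le> v \<Longrightarrow> (u + v) powr p / 2 powr (p - 1) \<le> \<theta> * u powr p + C * v powr p"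
proof
  \<comment> \<open>\<theta> solves \<open>\<theta> powr p = 2 powr (1 - p)\<close>. Convexity with
    weights \<theta> and 1 - \<theta> produces the factor
    \<open>\<theta> powr (1 - p) / 2 powr (p - 1)\<close>, which for this choice is \<theta>
    again.\<close>
  define \<theta> :: real where "\<theta> = 2 powr (- (p - 1) / p)"
  show \<theta>: "0 < \<theta>" "\<theta> < 1"
    using p_gt_1 powr_less_mono[of "- (p - 1) / p" 0 2] by (auto simp: \<theta>_def field_simps)
  show "0 \<le> (1 - \<theta>) powr (1 - p) / 2 powr (p - 1)"
    by simp
  fix u v :: real assume uv: "0 \<le> u" "0 \<le> v"
  have "u + v = \<theta> * (u / \<theta>) + (1 - \<theta>) * (v / (1 - \<theta>))"
    using \<theta> by simp
  also have "\<dots> powr p \<le> \<theta> * (u / \<theta>) powr p + (1 - \<theta>) * (v / (1 - \<theta>)) powr p"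
    using convex_onD[OF convex_on_powr_nonneg, of p "1 - \<theta>" "u / \<theta>" "v / (1 - \<theta>)"] p_gt_1 \<theta> uv
    by simp
  also have "\<dots> = \<theta> powr (1 - p) * u powr p + (1 - \<theta>) powr (1 - p) * v powr p"
    using \<theta> uv by (simp add: powr_divide powr_diff)
  finally have "(u + v) powr p / 2 powr (p - 1) \<le>
      \<theta> powr (1 - p) / 2 powr (p - 1) * u powr p + (1 - \<theta>) powr (1 - p) / 2 powr (p - 1) * v powr p"
    by (simp add: divide_right_mono flip: add_divide_distrib)
  moreover have "\<theta> powr (1 - p) / 2 powr (p - 1) = \<theta>"
    using p_gt_1 unfolding \<theta>_def powr_powr powr_diff[symmetric]
    by (intro arg_cong[where f = "(powr) 2"]) (simp add: field_simps)
  ultimately show "(u + v) powr p / 2 powr (p - 1)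
      \<le> \<theta> * u powr p + (1 - \<theta>) powr (1 - p) / 2 powr (p - 1) * v powr p"
    by simp
qed

text \<open>Of the dyadic blocks meeting \<open>{..<k}\<close> only the nested ones containing \<open>k\<close> are changed by
  truncation. Their contribution is a Hardy-type sum, which the potential
  \<open>(\<Sum>i<k. \<bar>b i\<bar>) powr p / 2 powr (R * (p - 1))\<close> absorbs in an induction over the scales.\<close>

lemma energy_truncate:
  obtains K where "0 \<le> K"
    "\<And>R k b. k \<le> 2 ^ R \<Longrightarrow> energy R (\<lambda>i. if i < k then b i else 0) \<le> K * energy R b"
proof -
  obtain \<theta> C' :: real where \<theta>: "0 < \<theta>" "\<theta> < 1" and C': "0 \<le> C'"
    and split: "\<And>u v. 0 \<le> u \<Longrightarrow> 0 \<le> v \<Longrightarrow> (u + v) powr p / 2 powr (p - 1) \<le> \<theta> * u powr p + C' * v powr p"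
    using powr_add_halved by blast
  \<comment> \<open>The solution of \<open>(1 + M) * \<theta> = M\<close>: the new top block
    together with the potential at the next scale costs at most the old potential.\<close>
  define M where "M = \<theta> / (1 - \<theta>)"
  \<comment> \<open>The first entry pays for a completed left half, the second for the potential of
    a single index at scale 0.\<close>
  define C where "C = max ((1 + M) * C') M"
  have M: "0 \<le> M" "(1 + M) * \<theta> = M"
    using \<theta> by (auto simp: M_def field_simps)
  have C: "0 \<le> C" "M \<le> C" "(1 + M) * C' \<le> C"
    using M by (auto simp: C_def)
  define A where "A R k b = (\<Sum>i<k. \<bar>b i\<bar>) powr p / (2 ^ R) powr (p - 1)" for R k :: nat and b :: "nat \<Rightarrow> real"
  have A_nonneg: "0 \<le> A R k b" for R k b
    by (simp add: A_def)
  \<comment> \<open>The last \<open>k\<close> terms are contracted by \<theta>, the first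
    \<open>m\<close> are paid for with \<open>C'\<close>. The uses are \<open>m = 0\<close> and
    \<open>m = 2 ^ R\<close>, the full left half.\<close>
  have A_Suc: "A (Suc R) (m + k) b \<le> \<theta> * A R k (\<lambda>i. b (m + i)) + C' * A R m b" for R k m b
  proof -
    have "A (Suc R) (m + k) b
        = ((\<Sum>i<m. \<bar>b i\<bar>) + (\<Sum>i<k. \<bar>b (m + i)\<bar>)) powr p / 2 powr (p - 1) / (2 ^ R) powr (p - 1)"
      by (simp add: A_def sum_lessThan_add powr_mult)
    also have "\<dots> \<le> (\<theta> * (\<Sum>i<k. \<bar>b (m + i)\<bar>) powr p + C' * (\<Sum>i<m. \<bar>b i\<bar>) powr p) / (2 ^ R) powr (p - 1)"
      using split[of "\<Sum>i<k. \<bar>b (m + i)\<bar>" "\<Sum>i<m. \<bar>b i\<bar>"]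
      by (intro divide_right_mono) (auto simp: sum_nonneg add.commute[of "\<Sum>i<m. \<bar>b i\<bar>"])
    finally show ?thesis
      by (simp add: A_def add_divide_distrib)
  qed
  have top: "\<bar>\<Sum>i<2 ^ R. if i < k then b i else 0\<bar> powr p / (2 ^ R) powr (p - 1) \<le> A R k b"
    if "k \<le> 2 ^ R" for R k b
    unfolding A_def sum_truncate[OF that] using p_gt_1
    by (intro divide_right_mono powr_mono2 sum_abs) auto
  have main: "energy R (\<lambda>i. if i < k then b i else 0) + M * A R k b
      \<le> energy R b + C * (\<Sum>i<2 ^ R. \<bar>b i\<bar> powr p)" if "k \<le> 2 ^ R" for R k b
    using that
  proof (induction R arbitrary: k b)
    case 0
    then have "k = 0 \<or> k = 1" by auto
    then show ?case
      using C p_gt_1 by (auto simp: energy_0 A_def intro!: mult_right_mono)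
  next
    case (Suc R)
    define b' where "b' = (\<lambda>i. b (2 ^ R + i))"
    have powsum: "(\<Sum>i<2 ^ Suc R. \<bar>b i\<bar> powr p) = (\<Sum>i<2 ^ R. \<bar>b i\<bar> powr p) + (\<Sum>i<2 ^ R. \<bar>b' i\<bar> powr p)"
      using sum_lessThan_add[of "\<lambda>i. \<bar>b i\<bar> powr p" "2 ^ R" "2 ^ R"] by (simp add: b'_def mult_2)
    have full: "energy R b + energy R b' \<le> energy (Suc R) b"
      unfolding energy_Suc b'_def by simp
    show ?case
    proof (cases "k \<le> 2 ^ R")
      case True
      have "(\<lambda>i. if 2 ^ R + i < k then b (2 ^ R + i) else 0) = (\<lambda>i. 0)"
        using True by auto
      then have "energy (Suc R) (\<lambda>i. if i < k then b i else 0) \<le> energy R (\<lambda>i. if i < k then b i else 0) + A (Suc R) k b"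
        unfolding energy_Suc using top[OF Suc.prems] by simp
      moreover have "(1 + M) * A (Suc R) k b \<le> (1 + M) * (\<theta> * A R k b)"
        using A_Suc[of R 0 k b] M by (intro mult_left_mono) (auto simp: A_def)
      then have "(1 + M) * A (Suc R) k b \<le> M * A R k b"
        unfolding mult.assoc[symmetric] M(2) .
      ultimately have "energy (Suc R) (\<lambda>i. if i < k then b i else 0) + M * A (Suc R) k b
          \<le> energy R (\<lambda>i. if i < k then b i else 0) + M * A R k b"
        by (simp add: distrib_right)
      also have "\<dots> \<le> energy R b + C * (\<Sum>i<2 ^ R. \<bar>b i\<bar> powr p)"
        using Suc.IH True by blast
      also have "\<dots> \<le> energy (Suc R) b + C * (\<Sum>i<2 ^ Suc R. \<bar>b i\<bar> powr p)"
        unfolding powsum using full energy_nonneg[of R b'] C(1)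
        by (intro add_mono mult_left_mono) (auto intro: sum_nonneg)
      finally show ?thesis .
    next
      case False
      define k' where "k' = k - 2 ^ R"
      have k: "k = 2 ^ R + k'" "k' \<le> 2 ^ R"
        using False Suc.prems by (auto simp: k'_def)
      \<comment> \<open>Every block inside the left half ends before \<open>k\<close>, so truncation
        does not change it.\<close>
      have "energy R (\<lambda>i. if i < k then b i else 0) = energy R b"
        unfolding energy_def
      proof (intro sum.cong refl)
        fix r g assume "r \<in> {..R}" "g \<in> {..<2 ^ (R - r) :: nat}"
        then have "(g + 1) * 2 ^ r \<le> 2 ^ (R - r) * 2 ^ r"
          by (intro mult_right_mono) auto
        also have "\<dots> = (2::nat) ^ R"
          using \<open>r \<in> {..R}\<close> by (simp flip: power_add)
        finally have "i < 2 ^ r \<Longrightarrow> g * 2 ^ r + i < k" for i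
          using k(1) by simp
        then show "\<bar>\<Sum>i<2 ^ r. if g * 2 ^ r + i < k then b (g * 2 ^ r + i) else 0\<bar> powr p / (2 ^ r) powr (p - 1)
            = \<bar>\<Sum>i<2 ^ r. b (g * 2 ^ r + i)\<bar> powr p / (2 ^ r) powr (p - 1)"
          by simp
      qed
      then have "energy (Suc R) (\<lambda>i. if i < k then b i else 0)
          \<le> energy R b + energy R (\<lambda>i. if i < k' then b' i else 0) + A (Suc R) k b"
        unfolding energy_Suc b'_def using top[OF Suc.prems, of b] by (simp add: k(1))
      \<comment> \<open>The completed left half is charged to its own p-th power sum. The recursion
        continues in the right half only, so each index is charged at most once over all
        scales.\<close>
      moreover have "A R (2 ^ R) b \<le> (\<Sum>i<2 ^ R. \<bar>b i\<bar> powr p)"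
        unfolding A_def by (rule powr_sum_le)
      then have "C' * A R (2 ^ R) b \<le> C' * (\<Sum>i<2 ^ R. \<bar>b i\<bar> powr p)"
        using C' by (rule mult_left_mono)
      then have "A (Suc R) k b \<le> \<theta> * A R k' b' + C' * (\<Sum>i<2 ^ R. \<bar>b i\<bar> powr p)"
        using A_Suc[of R "2 ^ R" k' b] by (simp add: k(1) b'_def)
      then have "(1 + M) * A (Suc R) k b \<le> (1 + M) * (\<theta> * A R k' b' + C' * (\<Sum>i<2 ^ R. \<bar>b i\<bar> powr p))"
        using M by (intro mult_left_mono) auto
      then have "(1 + M) * A (Suc R) k b \<le> M * A R k' b' + (1 + M) * C' * (\<Sum>i<2 ^ R. \<bar>b i\<bar> powr p)"
        using M(2) by (simp add: distrib_left mult.assoc[symmetric])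
      ultimately have "energy (Suc R) (\<lambda>i. if i < k then b i else 0) + M * A (Suc R) k b
          \<le> energy R b + (energy R (\<lambda>i. if i < k' then b' i else 0) + M * A R k' b')
            + (1 + M) * C' * (\<Sum>i<2 ^ R. \<bar>b i\<bar> powr p)"
        by (simp add: distrib_right)
      also have "\<dots> \<le> energy R b + (energy R b' + C * (\<Sum>i<2 ^ R. \<bar>b' i\<bar> powr p))
            + C * (\<Sum>i<2 ^ R. \<bar>b i\<bar> powr p)"
        using Suc.IH[OF k(2), of b'] mult_right_mono[OF C(3), of "\<Sum>i<2 ^ R. \<bar>b i\<bar> powr p"]
        by (simp add: sum_nonneg)
      also have "\<dots> \<le> energy (Suc R) b + C * (\<Sum>i<2 ^ Suc R. \<bar>b i\<bar> powr p)"
        unfolding powsum using full by (simp add: distrib_left)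
      finally show ?thesis .
    qed
  qed
  have "energy R (\<lambda>i. if i < k then b i else 0) \<le> (1 + C) * energy R b" if "k \<le> 2 ^ R" for R k b
    using main[OF that, of b] mult_nonneg_nonneg[OF M(1) A_nonneg[of R k b]]
      mult_left_mono[OF sum_powr_le_energy[of b R] C(1)]
    by (simp add: distrib_right)
  then show ?thesis
    using C(1) by (intro that[of "1 + C"]) auto
qed

lemma alternating_average_powr_le_energy:
  "\<bar>(\<Sum>i<2 ^ R. (- 1) ^ i * b i) / 2 ^ R\<bar> powr p \<le> energy R b / 2 ^ R"
proof -
  have "\<bar>(\<Sum>i<2 ^ R. (- 1) ^ i * b i) / 2 ^ R\<bar> \<le> (\<Sum>i<2 ^ R. \<bar>b i\<bar>) / 2 ^ R"
    using sum_abs[of "\<lambda>i. (- 1) ^ i * b i" "{..<2 ^ R}"] by (simp add: abs_mult divide_right_mono)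
  then have "\<bar>(\<Sum>i<2 ^ R. (- 1) ^ i * b i) / 2 ^ R\<bar> powr p \<le> ((\<Sum>i<2 ^ R. \<bar>b i\<bar>) / 2 ^ R) powr p"
    using p_gt_1 by (intro powr_mono2) auto
  also have "\<dots> \<le> (\<Sum>i<2 ^ R. \<bar>b i\<bar> powr p) / 2 ^ R"
    using powr_average_le[of p "{..<2 ^ R :: nat}" b] p_gt_1 by (simp add: lessThan_empty_iff)
  also have "\<dots> \<le> energy R b / 2 ^ R"
    by (intro divide_right_mono sum_powr_le_energy) auto
  finally show ?thesis .
qed

lemma sum_blocks:
  fixes f :: "nat \<Rightarrow> 'a::comm_monoid_add"
  shows "(\<Sum>g<m. \<Sum>i<n. f (g * n + i)) = (\<Sum>i<m * n. f i)"
proof (induction m)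
  case (Suc m)
  then show ?case
    using sum_lessThan_add[of f "m * n" n] by (simp add: add.commute[of n])
qed simp

text \<open>At each of the R + 1 scales the total average is the mean of the block averages, so by
  Jensen every scale contributes at least its p-th power.\<close>

lemma average_powr_le_energy:
  "(real R + 1) * \<bar>(\<Sum>i<2 ^ R. b i) / 2 ^ R\<bar> powr p \<le> energy R b / 2 ^ R"
proof -
  have "\<bar>(\<Sum>i<2 ^ R. b i) / 2 ^ R\<bar> powr p
      \<le> (\<Sum>g<2 ^ (R - r). \<bar>\<Sum>i<2 ^ r. b (g * 2 ^ r + i)\<bar> powr p / (2 ^ r) powr (p - 1)) / 2 ^ R"
    if "r \<le> R" for r
  proof -
    define s where "s g = (\<Sum>i<2 ^ r. b (g * 2 ^ r + i)) / 2 ^ r" for g :: nat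
    have R: "(2::nat) ^ (R - r) * 2 ^ r = 2 ^ R" "(2::real) ^ (R - r) * 2 ^ r = 2 ^ R"
      using that by (simp_all flip: power_add)
    have "(\<Sum>i<2 ^ R. b i) / 2 ^ R = (\<Sum>g<2 ^ (R - r). s g) / 2 ^ (R - r)"
      using sum_blocks[of b "2 ^ r" "2 ^ (R - r)"] R
      by (simp add: s_def field_simps flip: sum_divide_distrib)
    also have "\<bar>\<dots>\<bar> \<le> (\<Sum>g<2 ^ (R - r). \<bar>s g\<bar>) / 2 ^ (R - r)"
      by (simp add: divide_right_mono sum_abs)
    finally have "\<bar>(\<Sum>i<2 ^ R. b i) / 2 ^ R\<bar> powr p \<le> ((\<Sum>g<2 ^ (R - r). \<bar>s g\<bar>) / 2 ^ (R - r)) powr p"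
      using p_gt_1 by (intro powr_mono2) auto
    also have "\<dots> \<le> (\<Sum>g<2 ^ (R - r). \<bar>s g\<bar> powr p) / 2 ^ (R - r)"
      using powr_average_le[of p "{..<2 ^ (R - r) :: nat}" s] p_gt_1 by (simp add: lessThan_empty_iff)
    also have "\<dots> = (\<Sum>g<2 ^ (R - r). \<bar>\<Sum>i<2 ^ r. b (g * 2 ^ r + i)\<bar> powr p / (2 ^ r) powr (p - 1)) / 2 ^ R"
      by (simp add: s_def R(2)[symmetric] powr_divide powr_diff
          sum_divide_distrib[of _ "{..<2 ^ (R - r)}"])
    finally show ?thesis .
  qed
  then have "(\<Sum>r\<le>R. \<bar>(\<Sum>i<2 ^ R. b i) / 2 ^ R\<bar> powr p) \<le> energy R b / 2 ^ R"
    unfolding energy_def sum_divide_distrib[of _ "{..R}"] by (intro sum_mono) auto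
  then show ?thesis
    by (simp add: add.commute)
qed

text \<open>Blocks of length \<open>2 ^ r\<close> with r > 0 have even length and cancel; only scale
  0 is left.\<close>

lemma energy_alternating: "energy R (\<lambda>i. (- 1) ^ i) = 2 ^ R"
proof -
  have "\<bar>\<Sum>i<2 ^ r. (- 1) ^ (g * 2 ^ r + i) :: real\<bar> powr p / (2 ^ r) powr (p - 1) = (if r = 0 then 1 else 0)"
    for r g :: nat
  proof (cases r)
    case 0
    then show ?thesis by (simp add: power_abs)
  next
    case (Suc s)
    then have "even (g * 2 ^ r)" "even ((2::nat) ^ r)" by auto
    then have "(\<Sum>i<2 ^ r. (- 1) ^ (g * 2 ^ r + i) :: real) = 0"
      using sum_alternating_even[of "2 ^ r"] by (simp add: power_add)
    then show ?thesis using Suc by simp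
  qed
  then have "energy R (\<lambda>i. (- 1) ^ i) = (\<Sum>r\<le>R. if r = 0 then 2 ^ R else 0)"
    unfolding energy_def by (intro sum.cong refl) simp
  then show ?thesis by simp
qed

end

section \<open>Tags\<close>

lemma sum_eq_single:
  fixes f :: "'i \<Rightarrow> real"
  assumes "finite S" "t \<in> S" "\<And>s. s \<in> S \<Longrightarrow> s \<noteq> t \<Longrightarrow> f s = 0"
  shows "(\<Sum>s\<in>S. f s) = f t"
  using sum.mono_neutral_right[of S "{t}" f] assms by auto

text \<open>At most one summand over \<open>S\<close> is nonzero, so restricting to \<open>T\<close>
  either keeps the sum or gives 0. Pointwise, this is the unconditionality of disjointly supported
  functions.\<close>

lemma abs_le_abs_sum_disjoint:
  fixes f :: "'i \<Rightarrow> real"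
  assumes "finite S" "T \<subseteq> S" "\<And>s t. s \<in> S \<Longrightarrow> t \<in> S \<Longrightarrow> s \<noteq> t \<Longrightarrow> f s = 0 \<or> f t = 0"
  shows "\<bar>\<Sum>s\<in>T. f s\<bar> \<le> \<bar>\<Sum>s\<in>S. f s\<bar>"
proof (cases "\<exists>t\<in>T. f t \<noteq> 0")
  case True
  then obtain t where t: "t \<in> T" "f t \<noteq> 0" by blast
  then have "t \<in> S" using assms(2) by blast
  then have zero: "f s = 0" if "s \<in> S" "s \<noteq> t" for s
    using assms(3)[OF that(1) \<open>t \<in> S\<close> that(2)] t(2) by simp
  have "(\<Sum>s\<in>T. f s) = f t"
    using finite_subset[OF assms(2,1)] t(1) by (rule sum_eq_single) (use zero assms(2) in blast)
  moreover have "(\<Sum>s\<in>S. f s) = f t"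
    using assms(1) \<open>t \<in> S\<close> zero by (rule sum_eq_single)
  ultimately show ?thesis by simp
qed simp

text \<open>The intervals start at 1, which leaves the unit interval to the Haar functions, and have
  length 1, so each atom has norm 1.\<close>

definition atom :: "nat \<Rightarrow> real \<Rightarrow> real" where
  "atom m = indicat_real {real m + 1..<real m + 2}"

lemma atom_disjoint: "m \<noteq> n \<Longrightarrow> atom m x = 0 \<or> atom n x = 0"
  by (auto simp: atom_def indicator_def)

lemma atom_nonneg: "0 \<le> atom m x"
  by (simp add: atom_def)

lemma atom_eq_0: "x < 1 \<Longrightarrow> atom m x = 0"
  by (auto simp: atom_def indicator_def)

text \<open>An injective numbering by block \<open>j\<close>, scale \<open>r\<close> and dyadic
  group \<open>g\<close>, so that different triples get disjoint atoms.\<close>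

definition atom_code :: "nat \<Rightarrow> nat \<Rightarrow> nat \<Rightarrow> nat" where
  "atom_code j r g = prod_encode (j, prod_encode (r, g))"

lemma atom_code_eq_iff [simp]:
  "atom_code j r g = atom_code j' r' g' \<longleftrightarrow> j = j' \<and> r = r' \<and> g = g'"
  by (auto simp: atom_code_def)

context lp_space
begin

lemma powr_abs_sum_disjoint:
  fixes f :: "'i \<Rightarrow> real"
  assumes "finite S" "\<And>s t. s \<in> S \<Longrightarrow> t \<in> S \<Longrightarrow> s \<noteq> t \<Longrightarrow> f s = 0 \<or> f t = 0"
  shows "\<bar>\<Sum>s\<in>S. f s\<bar> powr p = (\<Sum>s\<in>S. \<bar>f s\<bar> powr p)"
proof (cases "\<exists>t\<in>S. f t \<noteq> 0")
  case True
  then obtain t where t: "t \<in> S" "f t \<noteq> 0" by blast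
  then have zero: "f s = 0" if "s \<in> S" "s \<noteq> t" for s
    using assms(2)[OF that(1) t(1) that(2)] by simp
  have "(\<Sum>s\<in>S. f s) = f t"
    using assms(1) t(1) zero by (rule sum_eq_single)
  moreover have "(\<Sum>s\<in>S. \<bar>f s\<bar> powr p) = \<bar>f t\<bar> powr p"
    using assms(1) t(1) by (rule sum_eq_single) (simp add: zero)
  ultimately show ?thesis by simp
qed (use p_gt_1 in simp)

lemma nrm_powr_sum_disjoint:
  fixes f :: "'i \<Rightarrow> real \<Rightarrow> real"
  assumes "finite S" "\<And>s. s \<in> S \<Longrightarrow> f s \<in> Lp p"
    and "\<And>s t x. s \<in> S \<Longrightarrow> t \<in> S \<Longrightarrow> s \<noteq> t \<Longrightarrow> f s x = 0 \<or> f t x = 0"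
  shows "nrm (\<lambda>x. \<Sum>s\<in>S. f s x) powr p = (\<Sum>s\<in>S. nrm (f s) powr p)"
proof -
  have "nrm (\<lambda>x. \<Sum>s\<in>S. f s x) powr p = (\<integral>x. (\<Sum>s\<in>S. \<bar>f s x\<bar> powr p) \<partial>lborel)"
    unfolding nrm_powr using assms by (intro Bochner_Integration.integral_cong powr_abs_sum_disjoint) auto
  also have "\<dots> = (\<Sum>s\<in>S. nrm (f s) powr p)"
    unfolding nrm_powr using assms Lp_integrable by (intro Bochner_Integration.integral_sum) auto
  finally show ?thesis .
qed

lemma Lp_indicator [intro]:
  assumes "A \<in> sets borel" "emeasure lborel A < \<infinity>"
  shows "indicat_real A \<in> Lp p"
proof (rule LpI)
  have "(\<lambda>x. \<bar>indicat_real A x\<bar> powr p) = indicat_real A"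
    using p_gt_1 by (auto simp: indicator_def)
  then show "integrable lborel (\<lambda>x. \<bar>indicat_real A x\<bar> powr p)"
    using assms by (simp add: integrable_real_indicator)
qed (use assms in auto)

lemma nrm_powr_indicator: "A \<in> sets borel \<Longrightarrow> nrm (indicat_real A) powr p = measure lborel A"
proof -
  have "(\<lambda>x. \<bar>indicat_real A x\<bar> powr p) = indicat_real A"
    using p_gt_1 by (auto simp: indicator_def)
  then show "A \<in> sets borel \<Longrightarrow> ?thesis"
    by (simp add: nrm_powr)
qed

lemma nrm_eq_1: "nrm f powr p = 1 \<Longrightarrow> nrm f = 1"
  using le_if_powr_le[of "nrm f" 1] le_if_powr_le[of 1 "nrm f"] by simp

lemma atom_in_Lp [intro]: "atom m \<in> Lp p"
  unfolding atom_def by (rule Lp_indicator) auto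

lemma nrm_atom [simp]: "nrm (atom m) = 1"
  unfolding atom_def by (rule nrm_eq_1, subst nrm_powr_indicator) auto

text \<open>The p-th root of \<open>1 / (2 ^ R * (2 ^ r) powr (p - 1))\<close>, the factor of a
  block sum of scale \<open>r\<close> in \<open>energy R b / 2 ^ R\<close>.\<close>

definition tag_weight :: "nat \<Rightarrow> nat \<Rightarrow> real" where
  "tag_weight R r = (2 ^ R) powr (- 1 / p) * (2 ^ r) powr (- (p - 1) / p)"

text \<open>The images of the unit vectors under an isometric copy of the norm
  \<open>(energy R b / 2 ^ R) powr (1 / p)\<close>; different \<open>j\<close> occupy disjoint sets of atoms.\<close>

definition tag :: "nat \<Rightarrow> nat \<Rightarrow> nat \<Rightarrow> real \<Rightarrow> real" where
  "tag j R i x = (\<Sum>r\<le>R. tag_weight R r * atom (atom_code j r (i div 2 ^ r)) x)"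

definition tag_sum :: "nat \<Rightarrow> nat \<Rightarrow> (nat \<Rightarrow> real) \<Rightarrow> real \<Rightarrow> real" where
  "tag_sum j R b x = (\<Sum>i<2 ^ R. b i * tag j R i x)"

lemma tag_weight_nonneg [simp]: "0 \<le> tag_weight R r"
  by (simp add: tag_weight_def)

lemma tag_nonneg: "0 \<le> tag j R i x"
  by (auto simp: tag_def atom_nonneg intro!: sum_nonneg)

lemma tag_in_Lp [intro]: "tag j R i \<in> Lp p"
  unfolding tag_def[abs_def] by (intro Lp_sum Lp_scale atom_in_Lp)

lemma tag_sum_in_Lp [intro]: "tag_sum j R b \<in> Lp p"
  unfolding tag_sum_def[abs_def] by (intro Lp_sum Lp_scale tag_in_Lp)

lemma tag_sum_eq_0: "x < 1 \<Longrightarrow> tag_sum j R b x = 0"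
  by (simp add: tag_sum_def tag_def atom_eq_0)

lemma tag_sum_nonzero: "tag_sum j R b x \<noteq> 0 \<Longrightarrow> \<exists>r g. atom (atom_code j r g) x \<noteq> 0"
  by (rule ccontr) (simp add: tag_sum_def tag_def)

lemma tag_sum_disjoint:
  assumes "j \<noteq> l" shows "tag_sum j R b x = 0 \<or> tag_sum l R' b' x = 0"
proof (rule ccontr)
  assume "\<not> ?thesis"
  then obtain r g r' g' where "atom (atom_code j r g) x \<noteq> 0" "atom (atom_code l r' g') x \<noteq> 0"
    using tag_sum_nonzero by blast
  then show False
    using assms atom_disjoint[of "atom_code j r g" "atom_code l r' g'" x] by simp
qed

text \<open>\<open>i div 2 ^ r\<close> is the number of the dyadic group of scale \<open>r\<close>
  containing \<open>i\<close>; collecting equal atoms therefore turns the coefficients into block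
  sums.\<close>

lemma tag_sum_eq:
  "tag_sum j R b x = (\<Sum>(r, g)\<in>(SIGMA r:{..R}. {..<2 ^ (R - r)}).
      tag_weight R r * (\<Sum>i<2 ^ r. b (g * 2 ^ r + i)) * atom (atom_code j r g) x)"
proof -
  have "tag_sum j R b x = (\<Sum>r\<le>R. \<Sum>i<2 ^ R. b i * (tag_weight R r * atom (atom_code j r (i div 2 ^ r)) x))"
    unfolding tag_sum_def tag_def sum_distrib_left by (rule sum.swap)
  also have "\<dots> = (\<Sum>r\<le>R. \<Sum>g<2 ^ (R - r). tag_weight R r * (\<Sum>i<2 ^ r. b (g * 2 ^ r + i)) * atom (atom_code j r g) x)"
  proof (rule sum.cong)
    fix r assume "r \<in> {..R}"
    then have "(2::nat) ^ (R - r) * 2 ^ r = 2 ^ R"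
      by (simp flip: power_add)
    then show "(\<Sum>i<2 ^ R. b i * (tag_weight R r * atom (atom_code j r (i div 2 ^ r)) x)) =
      (\<Sum>g<2 ^ (R - r). tag_weight R r * (\<Sum>i<2 ^ r. b (g * 2 ^ r + i)) * atom (atom_code j r g) x)"
      using sum_blocks[of "\<lambda>i. b i * (tag_weight R r * atom (atom_code j r (i div 2 ^ r)) x)" "2 ^ r" "2 ^ (R - r)"]
      by (simp add: sum_distrib_left sum_distrib_right mult_ac)
  qed simp
  also have "\<dots> = (\<Sum>(r, g)\<in>(SIGMA r:{..R}. {..<2 ^ (R - r)}).
      tag_weight R r * (\<Sum>i<2 ^ r. b (g * 2 ^ r + i)) * atom (atom_code j r g) x)"
    by (rule sum.Sigma) auto
  finally show ?thesis .
qed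

text \<open>After regrouping, the atoms are distinct, disjoint and of norm 1, so the p-th powers of
  their coefficients add.\<close>

lemma nrm_tag_sum: "nrm (tag_sum j R b) powr p = energy R b / 2 ^ R"
proof -
  have w: "tag_weight R r powr p = 1 / 2 ^ R / (2 ^ r) powr (p - 1)" for r
    using p_gt_1 powr_minus_divide[of "2 ^ r" "p - 1"]
    by (simp add: tag_weight_def powr_mult powr_divide powr_powr powr_minus_divide)
  define f where "f = (\<lambda>(r, g) x. tag_weight R r * (\<Sum>i<2 ^ r. b (g * 2 ^ r + i)) * atom (atom_code j r g) x)"
  have "tag_sum j R b = (\<lambda>x. \<Sum>s\<in>(SIGMA r:{..R}. {..<2 ^ (R - r)}). f s x)"
    unfolding tag_sum_eq f_def by (simp add: case_prod_unfold)
  then have "nrm (tag_sum j R b) powr p = nrm (\<lambda>x. \<Sum>s\<in>(SIGMA r:{..R}. {..<2 ^ (R - r)}). f s x) powr p"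
    by simp
  also have "\<dots> = (\<Sum>s\<in>(SIGMA r:{..R}. {..<2 ^ (R - r)}). nrm (f s) powr p)"
  proof (rule nrm_powr_sum_disjoint)
    fix s t :: "nat \<times> nat" and x assume "s \<noteq> t"
    then have "atom (atom_code j (fst s) (snd s)) x = 0 \<or> atom (atom_code j (fst t) (snd t)) x = 0"
      by (intro atom_disjoint) (auto simp: prod_eq_iff)
    then show "f s x = 0 \<or> f t x = 0"
      by (auto simp: f_def case_prod_unfold)
  qed (auto simp: f_def)
  also have "\<dots> = (\<Sum>(r, g)\<in>(SIGMA r:{..R}. {..<2 ^ (R - r)}).
      \<bar>\<Sum>i<2 ^ r. b (g * 2 ^ r + i)\<bar> powr p / (2 ^ r) powr (p - 1) / 2 ^ R)"
    by (intro sum.cong) (auto simp: f_def abs_mult powr_mult w)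
  also have "\<dots> = energy R b / 2 ^ R"
    unfolding energy_def sum_divide_distrib by (rule sum.Sigma[symmetric]) auto
  finally show ?thesis .
qed

text \<open>The point is the order of the quantifiers: one \<open>K\<close> serves all
  \<open>j\<close> and \<open>R\<close>, so blocks of unbounded length share a basis
  constant.\<close>

lemma nrm_tag_sum_truncate:
  obtains K where "0 \<le> K"
    "\<And>j R k b. k \<le> 2 ^ R \<Longrightarrow> nrm (tag_sum j R (\<lambda>i. if i < k then b i else 0)) \<le> K * nrm (tag_sum j R b)"
proof -
  obtain K where K: "0 \<le> K"
    "\<And>R k b. k \<le> 2 ^ R \<Longrightarrow> energy R (\<lambda>i. if i < k then b i else 0) \<le> K * energy R b"
    using energy_truncate by blast
  have "nrm (tag_sum j R (\<lambda>i. if i < k then b i else 0)) \<le> K powr (1 / p) * nrm (tag_sum j R b)"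
    if "k \<le> 2 ^ R" for j R k b
  proof (rule le_if_powr_le)
    show "nrm (tag_sum j R (\<lambda>i. if i < k then b i else 0)) powr p \<le> (K powr (1 / p) * nrm (tag_sum j R b)) powr p"
      using K(1) K(2)[OF that, of b] p_gt_1
      by (simp add: powr_mult powr_powr nrm_tag_sum divide_right_mono)
  qed auto
  then show ?thesis
    by (intro that[of "K powr (1 / p)"]) auto
qed

lemma alternating_average_le_nrm_tag_sum:
  "\<bar>(\<Sum>i<2 ^ R. (- 1) ^ i * b i) / 2 ^ R\<bar> \<le> nrm (tag_sum j R b)"
  using alternating_average_powr_le_energy[where R = R and b = b]
  by (intro le_if_powr_le[OF _ abs_ge_zero nrm_nonneg]) (simp add: nrm_tag_sum)

text \<open>The gain \<open>(real R + 1) powr (- 1 / p)\<close> is what makes the perturbation by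
  the absolute values small.\<close>

lemma average_le_nrm_tag_sum:
  "\<bar>(\<Sum>i<2 ^ R. b i) / 2 ^ R\<bar> \<le> (real R + 1) powr (- 1 / p) * nrm (tag_sum j R b)"
proof (rule le_if_powr_le)
  show "\<bar>(\<Sum>i<2 ^ R. b i) / 2 ^ R\<bar> powr p \<le> ((real R + 1) powr (- 1 / p) * nrm (tag_sum j R b)) powr p"
  proof -
    have "((real R + 1) powr (- 1 / p) * nrm (tag_sum j R b)) powr p = energy R b / 2 ^ R / (real R + 1)"
      using p_gt_1 by (simp add: powr_mult powr_divide powr_powr powr_minus_divide nrm_tag_sum add.commute)
    then show ?thesis
      using average_powr_le_energy[of R b] by (simp add: pos_le_divide_eq mult_ac)
  qed
qed auto

lemma nrm_tag_sum_alternating: "nrm (tag_sum j R (\<lambda>i. (- 1) ^ i)) = 1"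
  by (rule nrm_eq_1) (simp add: nrm_tag_sum energy_alternating)

end

section \<open>Closed spans and Schauder basic sequences\<close>

lemma sum_pad:
  fixes c :: "nat \<Rightarrow> real"
  assumes "n \<le> N"
  shows "(\<Sum>j<N. (if j < n then c j else 0) * f j) = (\<Sum>j<n. c j * f j)"
  using assms by (intro sum.mono_neutral_cong_right) auto

context lp_space
begin

lemma closed_spanI:
  assumes "f \<in> Lp p"
    and "\<And>e. 0 < e \<Longrightarrow> \<exists>n c. nrm (\<lambda>x. f x - (\<Sum>j<n. c j * z j x)) < e"
  shows "f \<in> closed_span p z"
  using assms by (simp add: closed_span_def)

lemma closed_span_in_Lp: "f \<in> closed_span p z \<Longrightarrow> f \<in> Lp p"
  by (simp add: closed_span_def)

lemma closed_spanD:
  "f \<in> closed_span p z \<Longrightarrow> 0 < e \<Longrightarrow> \<exists>n c. nrm (\<lambda>x. f x - (\<Sum>j<n. c j * z j x)) < e"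
  by (simp add: closed_span_def)

lemma lincomb_in_closed_span:
  assumes "\<And>j. z j \<in> Lp p"
  shows "(\<lambda>x. \<Sum>j<n. c j * z j x) \<in> closed_span p z"
proof (rule closed_spanI)
  show "(\<lambda>x. \<Sum>j<n. c j * z j x) \<in> Lp p"
    using assms by (intro Lp_sum Lp_scale)
  show "\<exists>m d. nrm (\<lambda>x. (\<Sum>j<n. c j * z j x) - (\<Sum>j<m. d j * z j x)) < e" if "0 < e" for e
    using that by (intro exI[of _ n] exI[of _ c]) simp
qed

lemma closed_span_zero: "(\<lambda>x. 0) \<in> closed_span p z"
  by (rule closed_spanI) (auto intro!: exI[of _ 0])

lemma closed_span_closed:
  assumes "f \<in> Lp p" "\<And>j. z j \<in> Lp p"
    and approx: "\<And>e. 0 < e \<Longrightarrow> \<exists>g\<in>closed_span p z. nrm (\<lambda>x. f x - g x) < e"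
  shows "f \<in> closed_span p z"
proof (rule closed_spanI[OF assms(1)])
  fix e :: real assume "0 < e"
  then obtain g where g: "g \<in> closed_span p z" "nrm (\<lambda>x. f x - g x) < e / 2"
    using approx[of "e / 2"] by auto
  obtain n c where c: "nrm (\<lambda>x. g x - (\<Sum>j<n. c j * z j x)) < e / 2"
    using closed_spanD[OF g(1), of "e / 2"] \<open>0 < e\<close> by auto
  have "nrm (\<lambda>x. (f x - g x) + (g x - (\<Sum>j<n. c j * z j x))) \<le> nrm (\<lambda>x. f x - g x) + nrm (\<lambda>x. g x - (\<Sum>j<n. c j * z j x))"
    using assms closed_span_in_Lp[OF g(1)] by (intro nrm_triangle Lp_minus Lp_sum Lp_scale)
  then show "\<exists>n c. nrm (\<lambda>x. f x - (\<Sum>j<n. c j * z j x)) < e"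
    using g(2) c by (intro exI[of _ n] exI[of _ c]) simp
qed

lemma closed_span_add:
  assumes f: "f \<in> closed_span p z" and g: "g \<in> closed_span p z" and z: "\<And>j. z j \<in> Lp p"
  shows "(\<lambda>x. f x + g x) \<in> closed_span p z"
proof (rule closed_spanI)
  note Lp = closed_span_in_Lp[OF f] closed_span_in_Lp[OF g]
  show "(\<lambda>x. f x + g x) \<in> Lp p"
    using Lp by (rule Lp_add)
  fix e :: real assume "0 < e"
  obtain n c where c: "nrm (\<lambda>x. f x - (\<Sum>j<n. c j * z j x)) < e / 2"
    using closed_spanD[OF f, of "e / 2"] \<open>0 < e\<close> by auto
  obtain m d where d: "nrm (\<lambda>x. g x - (\<Sum>j<m. d j * z j x)) < e / 2"
    using closed_spanD[OF g, of "e / 2"] \<open>0 < e\<close> by auto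
  define b where "b j = (if j < n then c j else 0) + (if j < m then d j else 0)" for j
  have "(\<Sum>j<max n m. b j * z j x) = (\<Sum>j<n. c j * z j x) + (\<Sum>j<m. d j * z j x)" for x
    unfolding b_def distrib_right sum.distrib by (simp only: sum_pad max.cobounded1 max.cobounded2)
  moreover have "nrm (\<lambda>x. (f x - (\<Sum>j<n. c j * z j x)) + (g x - (\<Sum>j<m. d j * z j x))) < e"
  proof -
    have "(\<lambda>x. \<Sum>j<n. c j * z j x) \<in> Lp p" "(\<lambda>x. \<Sum>j<m. d j * z j x) \<in> Lp p"
      using z by (intro Lp_sum Lp_scale; blast)+
    then show ?thesis
      using nrm_triangle[OF Lp_minus[OF Lp(1)] Lp_minus[OF Lp(2)],
          of "\<lambda>x. \<Sum>j<n. c j * z j x" "\<lambda>x. \<Sum>j<m. d j * z j x"] c d by simp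
  qed
  ultimately show "\<exists>k b. nrm (\<lambda>x. f x + g x - (\<Sum>j<k. b j * z j x)) < e"
    by (intro exI[of _ "max n m"] exI[of _ b]) (simp add: algebra_simps)
qed

lemma closed_span_scale:
  assumes f: "f \<in> closed_span p z" and z: "\<And>j. z j \<in> Lp p"
  shows "(\<lambda>x. a * f x) \<in> closed_span p z"
proof (rule closed_spanI)
  show "(\<lambda>x. a * f x) \<in> Lp p"
    using closed_span_in_Lp[OF f] by (rule Lp_scale)
  fix e :: real assume "0 < e"
  then obtain n c where c: "nrm (\<lambda>x. f x - (\<Sum>j<n. c j * z j x)) < e / (\<bar>a\<bar> + 1)"
    using closed_spanD[OF f, of "e / (\<bar>a\<bar> + 1)"] by (auto simp: add_nonneg_pos)
  have "nrm (\<lambda>x. a * f x - (\<Sum>j<n. a * c j * z j x)) = nrm (\<lambda>x. a * (f x - (\<Sum>j<n. c j * z j x)))"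
    by (simp add: right_diff_distrib sum_distrib_left mult.assoc)
  also have "\<dots> \<le> (\<bar>a\<bar> + 1) * nrm (\<lambda>x. f x - (\<Sum>j<n. c j * z j x))"
    by (simp add: mult_right_mono)
  also have "\<dots> < e"
    using c by (simp add: field_simps add_nonneg_pos)
  finally show "\<exists>n c. nrm (\<lambda>x. a * f x - (\<Sum>j<n. c j * z j x)) < e"
    by (intro exI[of _ n] exI[of _ "\<lambda>j. a * c j"])
qed

lemma closed_span_sum:
  assumes "\<And>i. i \<in> I \<Longrightarrow> f i \<in> closed_span p z" and z: "\<And>j. z j \<in> Lp p"
  shows "(\<lambda>x. \<Sum>i\<in>I. f i x) \<in> closed_span p z"
  using assms(1)
proof (induction I rule: infinite_finite_induct)
  case (insert i I)
  then show ?case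
    using closed_span_add[of "f i" z "\<lambda>x. \<Sum>i\<in>I. f i x"] z by simp
qed (simp_all add: closed_span_zero)

lemma closed_span_trans:
  assumes "f \<in> closed_span p h" "\<And>j. h j \<in> closed_span p z" "\<And>j. z j \<in> Lp p"
  shows "f \<in> closed_span p z"
proof (rule closed_span_closed)
  fix e :: real assume "0 < e"
  then obtain n c where "nrm (\<lambda>x. f x - (\<Sum>j<n. c j * h j x)) < e"
    using closed_spanD[OF assms(1)] by blast
  moreover have "(\<lambda>x. \<Sum>j<n. c j * h j x) \<in> closed_span p z"
    using assms(2,3) by (intro closed_span_sum closed_span_scale)
  ultimately show "\<exists>g\<in>closed_span p z. nrm (\<lambda>x. f x - g x) < e"
    by (rule bexI)
qed (use assms(3) closed_span_in_Lp[OF assms(1)] in simp_all)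

text \<open>Uniformly bounded partial sums make the coordinates bounded functionals. Hence the
  coefficients of finite approximants of \<open>f\<close> are Cauchy, and their limits expand
  \<open>f\<close>. As \<open>f\<close> is given beforehand, completeness is applied to real
  coefficients only.\<close>

lemma Grunblum_criterion:
  assumes z: "\<And>j. z j \<in> Lp p" and pos: "\<And>j. 0 < nrm (z j)"
    and basic: "\<And>c m n. m \<le> n \<Longrightarrow>
      nrm (\<lambda>x. \<Sum>j<m. c j * z j x) \<le> K * nrm (\<lambda>x. \<Sum>j<n. c j * z j x)"
  shows "schauder_basic p z"
proof -
  define S where "S c n x = (\<Sum>j<n. c j * z j x)" for c :: "nat \<Rightarrow> real" and n x
  have S_Lp [intro]: "S c n \<in> Lp p" for c n
    unfolding S_def[abs_def] using z by (intro Lp_sum Lp_scale)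
  have S_basic: "nrm (S c m) \<le> K * nrm (S c n)" if "m \<le> n" for c m n
    using basic[OF that] by (simp add: S_def[abs_def])
  have S_diff: "S (\<lambda>j. c j - d j) n x = S c n x - S d n x" for c d n x
    by (simp add: S_def left_diff_distrib sum_subtractf)
  have "0 \<le> K"
  proof -
    have "nrm (S (\<lambda>_. 1) 1) = nrm (z 0)" by (simp add: S_def[abs_def])
    then have "nrm (z 0) \<le> K * nrm (z 0)" using S_basic[of 1 1 "\<lambda>_. 1"] by simp
    then show ?thesis using pos[of 0] by simp
  qed
  have coeff: "\<bar>c k\<bar> * nrm (z k) \<le> 2 * K * nrm (S c n)" if "k < n" for c k n
  proof -
    have "\<bar>c k\<bar> * nrm (z k) = nrm (\<lambda>x. S c (Suc k) x - S c k x)"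
      by (simp add: S_def)
    also have "\<dots> \<le> nrm (S c (Suc k)) + nrm (S c k)"
      by (rule nrm_triangle_minus) auto
    also have "\<dots> \<le> 2 * K * nrm (S c n)"
      using S_basic[of "Suc k" n c] S_basic[of k n c] that by simp
    finally show ?thesis .
  qed
  have "\<exists>!c. (\<lambda>n. nrm (\<lambda>x. f x - S c n x)) \<longlonglongrightarrow> 0" if f: "f \<in> closed_span p z" for f
  proof (rule ex_ex1I)
    note f_Lp = closed_span_in_Lp[OF f]
    define e where "e i = 1 / (real i + 1)" for i
    have e: "0 < e i" for i by (simp add: e_def)
    have e_lim: "e \<longlonglongrightarrow> 0"
      using LIMSEQ_inverse_real_of_nat by (simp add: e_def[abs_def] inverse_eq_divide add.commute)
    have "\<forall>i. \<exists>q. nrm (\<lambda>x. f x - (\<Sum>j<fst q. snd q j * z j x)) < e i"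
    proof
      fix i
      obtain n c where "nrm (\<lambda>x. f x - (\<Sum>j<n. c j * z j x)) < e i"
        using closed_spanD[OF f e] by blast
      then show "\<exists>q. nrm (\<lambda>x. f x - (\<Sum>j<fst q. snd q j * z j x)) < e i"
        by (intro exI[of _ "(n, c)"]) simp
    qed
    from choice[OF this] obtain q
      where q: "\<And>i. nrm (\<lambda>x. f x - (\<Sum>j<fst (q i). snd (q i) j * z j x)) < e i"
      by blast
    define N where "N i = fst (q i)" for i
    \<comment> \<open>Padding with 0 makes the i-th approximant a full coefficient sequence whose
      partial sums are constant from \<open>N i\<close> on.\<close>
    define d where "d i k = (if k < N i then snd (q i) k else 0)" for i k
    have d: "nrm (\<lambda>x. f x - S (d i) n x) < e i" if "N i \<le> n" for i n
      using q[of i] that by (simp add: S_def d_def sum_pad N_def)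
    \<comment> \<open>Both approximants are close to \<open>f\<close> at an index beyond both
      lengths; the hypothesis carries the bound back to every \<open>n\<close>.\<close>
    have diff: "nrm (S (\<lambda>j. d i j - d l j) n) \<le> K * (e i + e l)" for i l n
    proof -
      define m where "m = max n (max (N i) (N l))"
      have "nrm (S (\<lambda>j. d i j - d l j) m) = nrm (\<lambda>x. (f x - S (d l) m x) - (f x - S (d i) m x))"
        by (intro arg_cong[where f = nrm] ext) (simp add: S_diff)
      also have "\<dots> \<le> nrm (\<lambda>x. f x - S (d l) m x) + nrm (\<lambda>x. f x - S (d i) m x)"
        using f_Lp by (intro nrm_triangle_minus) auto
      also have "\<dots> \<le> e i + e l"
        using d[of i m] d[of l m] by (simp add: m_def le_max_iff_disj)
      finally have "K * nrm (S (\<lambda>j. d i j - d l j) m) \<le> K * (e i + e l)"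
        using \<open>0 \<le> K\<close> by (rule mult_left_mono)
      moreover have "nrm (S (\<lambda>j. d i j - d l j) n) \<le> K * nrm (S (\<lambda>j. d i j - d l j) m)"
        by (rule S_basic) (simp add: m_def)
      ultimately show ?thesis by simp
    qed
    have "convergent (\<lambda>i. d i k)" for k
    proof (rule Cauchy_convergent, rule CauchyI)
      fix r :: real assume "0 < r"
      define C where "C = 2 * K * K / nrm (z k)"
      have "0 \<le> C" using \<open>0 \<le> K\<close> by (simp add: C_def)
      have bd: "\<bar>d i k - d l k\<bar> \<le> C * (e i + e l)" for i l
      proof -
        have "\<bar>d i k - d l k\<bar> * nrm (z k) \<le> 2 * K * nrm (S (\<lambda>j. d i j - d l j) (Suc k))"
          using coeff[of k "Suc k" "\<lambda>j. d i j - d l j"] by simp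
        also have "\<dots> \<le> 2 * K * (K * (e i + e l))"
          using \<open>0 \<le> K\<close> by (intro mult_left_mono diff) auto
        finally show ?thesis
          using pos[of k] by (simp add: C_def field_simps)
      qed
      have "(\<lambda>i. C * e i) \<longlonglongrightarrow> C * 0"
        using e_lim by (intro tendsto_intros)
      then obtain M where M: "\<And>i. M \<le> i \<Longrightarrow> C * e i < r / 2"
        using order_tendstoD(2)[of "\<lambda>i. C * e i" "C * 0" sequentially "r / 2"] \<open>0 < r\<close>
        by (auto simp: eventually_sequentially)
      have "norm (d i k - d l k) < r" if "M \<le> i" "M \<le> l" for i l
        using bd[of i l] M[OF that(1)] M[OF that(2)] by (simp add: distrib_left)
      then show "\<exists>M. \<forall>m\<ge>M. \<forall>n\<ge>M. norm (d m k - d n k) < r"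
        by blast
    qed
    then have "\<forall>k. \<exists>c. (\<lambda>i. d i k) \<longlonglongrightarrow> c"
      by (simp add: convergent_def)
    from choice[OF this] obtain c where c: "\<And>k. (\<lambda>i. d i k) \<longlonglongrightarrow> c k"
      by blast
    \<comment> \<open>Here \<open>l\<close> tends to infinity in \<open>diff\<close>. Only finitely
      many coordinates enter for fixed \<open>m\<close>, so coordinatewise convergence suffices, and
      the bound does not depend on \<open>m\<close>.\<close>
    have dc: "nrm (S (\<lambda>j. d i j - c j) m) \<le> K * e i" for i m
    proof (rule LIMSEQ_le_const)
      have "(\<lambda>l. \<Sum>j<m. \<bar>d l j - c j\<bar> * nrm (z j)) \<longlonglongrightarrow> (\<Sum>j<m. \<bar>c j - c j\<bar> * nrm (z j))"
        using c by (intro tendsto_intros)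
      moreover have "(\<lambda>l. K * (e i + e l)) \<longlonglongrightarrow> K * (e i + 0)"
        using e_lim by (intro tendsto_intros)
      ultimately have "(\<lambda>l. K * (e i + e l) + (\<Sum>j<m. \<bar>d l j - c j\<bar> * nrm (z j)))
          \<longlonglongrightarrow> K * (e i + 0) + (\<Sum>j<m. \<bar>c j - c j\<bar> * nrm (z j))"
        by (rule tendsto_add[rotated])
      then show "(\<lambda>l. K * (e i + e l) + (\<Sum>j<m. \<bar>d l j - c j\<bar> * nrm (z j))) \<longlonglongrightarrow> K * e i"
        by simp
      have "nrm (S (\<lambda>j. d i j - c j) m) \<le> K * (e i + e l) + (\<Sum>j<m. \<bar>d l j - c j\<bar> * nrm (z j))" for l
      proof -
        have "nrm (S (\<lambda>j. d i j - c j) m) = nrm (\<lambda>x. S (\<lambda>j. d i j - d l j) m x + S (\<lambda>j. d l j - c j) m x)"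
          by (intro arg_cong[where f = nrm] ext) (simp add: S_diff)
        also have "\<dots> \<le> nrm (S (\<lambda>j. d i j - d l j) m) + nrm (S (\<lambda>j. d l j - c j) m)"
          by (rule nrm_triangle) auto
        also have "nrm (S (\<lambda>j. d l j - c j) m) \<le> (\<Sum>j<m. nrm (\<lambda>x. (d l j - c j) * z j x))"
          unfolding S_def[abs_def] using z by (intro nrm_sum Lp_scale)
        finally show ?thesis
          using diff[of i l m] by simp
      qed
      then show "\<exists>N. \<forall>n\<ge>N. nrm (S (\<lambda>j. d i j - c j) m) \<le> K * (e i + e n) + (\<Sum>j<m. \<bar>d n j - c j\<bar> * nrm (z j))"
        by blast
    qed
    have fc: "nrm (\<lambda>x. f x - S c m x) \<le> (1 + K) * e i" if "N i \<le> m" for i m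
    proof -
      have "nrm (\<lambda>x. f x - S c m x) = nrm (\<lambda>x. (f x - S (d i) m x) + S (\<lambda>j. d i j - c j) m x)"
        by (intro arg_cong[where f = nrm] ext) (simp add: S_diff)
      also have "\<dots> \<le> nrm (\<lambda>x. f x - S (d i) m x) + nrm (S (\<lambda>j. d i j - c j) m)"
        using f_Lp by (intro nrm_triangle) auto
      finally show ?thesis
        using d[OF that] dc[of i m] by (simp add: distrib_right)
    qed
    have "(\<lambda>n. nrm (\<lambda>x. f x - S c n x)) \<longlonglongrightarrow> 0"
    proof (rule LIMSEQ_I)
      fix r :: real assume "0 < r"
      have "(\<lambda>i. (1 + K) * e i) \<longlonglongrightarrow> (1 + K) * 0"
        using e_lim by (intro tendsto_intros)
      then have "eventually (\<lambda>i. (1 + K) * e i < r) sequentially"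
        using \<open>0 < r\<close> by (intro order_tendstoD(2)[of _ "(1 + K) * 0"]) auto
      then obtain i where "(1 + K) * e i < r"
        by (auto simp: eventually_sequentially)
      then have "norm (nrm (\<lambda>x. f x - S c n x) - 0) < r" if "N i \<le> n" for n
        using fc[OF that] by simp
      then show "\<exists>no. \<forall>n\<ge>no. norm (nrm (\<lambda>x. f x - S c n x) - 0) < r"
        by blast
    qed
    then show "\<exists>c. (\<lambda>n. nrm (\<lambda>x. f x - S c n x)) \<longlonglongrightarrow> 0"
      by blast
  next
    fix c d :: "nat \<Rightarrow> real"
    assume c: "(\<lambda>n. nrm (\<lambda>x. f x - S c n x)) \<longlonglongrightarrow> 0"
      and d: "(\<lambda>n. nrm (\<lambda>x. f x - S d n x)) \<longlonglongrightarrow> 0"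
    note f_Lp = closed_span_in_Lp[OF f]
    show "c = d"
    proof
      fix k
      \<comment> \<open>Two expansions of \<open>f\<close> have a difference whose partial sums tend
        to 0, and these control each coordinate.\<close>
      have le: "nrm (S (\<lambda>j. c j - d j) n) \<le> nrm (\<lambda>x. f x - S d n x) + nrm (\<lambda>x. f x - S c n x)" for n
      proof -
        have "nrm (S (\<lambda>j. c j - d j) n) = nrm (\<lambda>x. (f x - S d n x) - (f x - S c n x))"
          by (intro arg_cong[where f = nrm] ext) (simp add: S_diff)
        also have "\<dots> \<le> nrm (\<lambda>x. f x - S d n x) + nrm (\<lambda>x. f x - S c n x)"
          using f_Lp by (intro nrm_triangle_minus) auto
        finally show ?thesis .
      qed
      have "\<bar>c k - d k\<bar> * nrm (z k) \<le> 0"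
      proof (rule LIMSEQ_le_const)
        show "(\<lambda>n. 2 * K * (nrm (\<lambda>x. f x - S d n x) + nrm (\<lambda>x. f x - S c n x))) \<longlonglongrightarrow> 0"
          using tendsto_mult[OF tendsto_const tendsto_add[OF d c], of "2 * K"] by simp
        have "\<bar>c k - d k\<bar> * nrm (z k) \<le> 2 * K * (nrm (\<lambda>x. f x - S d n x) + nrm (\<lambda>x. f x - S c n x))"
          if "Suc k \<le> n" for n
          using coeff[of k n "\<lambda>j. c j - d j"] that mult_left_mono[OF le[of n], of "2 * K"] \<open>0 \<le> K\<close> by simp
        then show "\<exists>N. \<forall>n\<ge>N. \<bar>c k - d k\<bar> * nrm (z k) \<le> 2 * K * (nrm (\<lambda>x. f x - S d n x) + nrm (\<lambda>x. f x - S c n x))"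
          by blast
      qed
      then show "c k = d k"
        using pos[of k] by (simp add: mult_le_0_iff)
    qed
  qed
  then show ?thesis
    unfolding schauder_basic_def S_def using z by blast
qed

section \<open>The non-negative system\<close>

lemma nrm_triangle3:
  assumes "f \<in> Lp p" "g \<in> Lp p" "h \<in> Lp p"
  shows "nrm (\<lambda>x. f x + g x + h x) \<le> nrm f + nrm g + nrm h"
  using nrm_triangle[OF Lp_add[OF assms(1,2)] assms(3)] nrm_triangle[OF assms(1,2)] by linarith

text \<open>This functional equals 1 on the alternating sequence; in a block sum it becomes the
  coefficient of the Haar function.\<close>

definition alt_avg :: "nat \<Rightarrow> (nat \<Rightarrow> real) \<Rightarrow> real" where
  "alt_avg R b = (\<Sum>i<2 ^ R. (- 1) ^ i * b i) / 2 ^ R"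

definition avg :: "nat \<Rightarrow> (nat \<Rightarrow> real) \<Rightarrow> real" where
  "avg R b = (\<Sum>i<2 ^ R. b i) / 2 ^ R"

definition alt_tag :: "nat \<Rightarrow> nat \<Rightarrow> real \<Rightarrow> real" where
  "alt_tag j R = tag_sum j R (\<lambda>i. (- 1) ^ i)"

definition tag_rest :: "nat \<Rightarrow> nat \<Rightarrow> (nat \<Rightarrow> real) \<Rightarrow> real \<Rightarrow> real" where
  "tag_rest j R b x = tag_sum j R b x - alt_avg R b * alt_tag j R x"

lemma alt_tag_in_Lp [intro]: "alt_tag j R \<in> Lp p"
  unfolding alt_tag_def by (rule tag_sum_in_Lp)

lemma nrm_alt_tag [simp]: "nrm (alt_tag j R) = 1"
  unfolding alt_tag_def by (rule nrm_tag_sum_alternating)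

text \<open>The remainder is itself a tag sum, so supports, disjointness and norm bounds carry over
  to it.\<close>

lemma tag_rest_eq: "tag_rest j R b = tag_sum j R (\<lambda>i. b i - alt_avg R b * (- 1) ^ i)"
  by (rule ext)
    (simp add: tag_rest_def alt_tag_def tag_sum_def left_diff_distrib sum_subtractf sum_distrib_left mult.assoc)

lemma tag_rest_in_Lp [intro]: "tag_rest j R b \<in> Lp p"
  unfolding tag_rest_eq by (rule tag_sum_in_Lp)

lemma tag_rest_eq_0: "x < 1 \<Longrightarrow> tag_rest j R b x = 0"
  unfolding tag_rest_eq by (rule tag_sum_eq_0)

lemma tag_rest_disjoint: "j \<noteq> l \<Longrightarrow> tag_rest j R b x = 0 \<or> tag_rest l R' b' x = 0"
  unfolding tag_rest_eq by (rule tag_sum_disjoint)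

lemma abs_alt_avg_le: "\<bar>alt_avg R b\<bar> \<le> nrm (tag_sum j R b)"
  unfolding alt_avg_def by (rule alternating_average_le_nrm_tag_sum)

lemma nrm_tag_rest_le: "nrm (tag_rest j R b) \<le> 2 * nrm (tag_sum j R b)"
proof -
  have "nrm (tag_rest j R b) \<le> nrm (tag_sum j R b) + nrm (\<lambda>x. alt_avg R b * alt_tag j R x)"
    unfolding tag_rest_def[abs_def] by (intro nrm_triangle_minus tag_sum_in_Lp Lp_scale alt_tag_in_Lp)
  then show ?thesis
    using abs_alt_avg_le[of R b j] by simp
qed

lemma nrm_tag_sum_le_rest: "nrm (tag_sum j R b) \<le> nrm (tag_rest j R b) + \<bar>alt_avg R b\<bar>"
proof -
  have "nrm (\<lambda>x. tag_rest j R b x + alt_avg R b * alt_tag j R x)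
      \<le> nrm (tag_rest j R b) + nrm (\<lambda>x. alt_avg R b * alt_tag j R x)"
    by (intro nrm_triangle tag_rest_in_Lp Lp_scale alt_tag_in_Lp)
  then show ?thesis
    by (simp add: tag_rest_def)
qed

text \<open>For R > 0 the alternating sequence has average 0, so removing it does not change the
  plain average. The bound must be by \<open>tag_rest\<close>, since only this part of the tags
  survives in a block sum.\<close>

lemma abs_avg_le:
  assumes "0 < R"
  shows "\<bar>avg R b\<bar> \<le> (real R + 1) powr (- 1 / p) * nrm (tag_rest j R b)"
proof -
  have "(\<Sum>i<2 ^ R. (- 1) ^ i :: real) = 0"
    using assms by (intro sum_alternating_even) auto
  then have "avg R b = (\<Sum>i<2 ^ R. b i - alt_avg R b * (- 1) ^ i) / 2 ^ R"
    by (simp add: avg_def sum_subtractf flip: sum_distrib_left)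
  then show ?thesis
    unfolding tag_rest_eq using average_le_nrm_tag_sum by simp
qed

end

text \<open>Only three properties of the Haar basis enter: it is normalised, it has basis constant
  1, and it vanishes where the atoms live. The bounds \<open>1 / 2 ^ (j + 3)\<close> are chosen so
  that, doubled by \<open>nrm_shifted\<close>, they sum to at most 1/2.\<close>

locale tagged_system = lp_space +
  fixes h :: "nat \<Rightarrow> real \<Rightarrow> real" and R :: "nat \<Rightarrow> nat"
  assumes h_in_Lp: "h j \<in> Lp p"
    and nrm_h: "nrm (h j) = 1"
    and h_eq_0: "1 \<le> x \<Longrightarrow> h j x = 0"
    and h_monotone: "m \<le> n \<Longrightarrow> nrm (\<lambda>x. \<Sum>j<m. a j * h j x) \<le> nrm (\<lambda>x. \<Sum>j<n. a j * h j x)"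
    and R_pos: "0 < R j"
    and R_large: "(real (R j) + 1) powr (- 1 / p) \<le> 1 / 2 ^ (j + 3)"
begin

abbreviation shifted :: "nat \<Rightarrow> real \<Rightarrow> real" where
  "shifted j x \<equiv> h j x - alt_tag j (R j) x"

definition block :: "nat \<Rightarrow> nat \<Rightarrow> real \<Rightarrow> real" where
  "block j i x = tag j (R j) i x + (\<bar>shifted j x\<bar> + (- 1) ^ i * shifted j x) / 2 ^ R j"

definition block_sum :: "nat \<Rightarrow> (nat \<Rightarrow> real) \<Rightarrow> real \<Rightarrow> real" where
  "block_sum j b x = (\<Sum>i<2 ^ R j. b i * block j i x)"

lemma shifted_in_Lp: "shifted j \<in> Lp p"
  by (intro Lp_minus h_in_Lp alt_tag_in_Lp)

lemma nrm_shifted: "nrm (shifted j) \<le> 2"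
  using nrm_triangle_minus[OF h_in_Lp alt_tag_in_Lp, of j j "R j"] by (simp add: nrm_h)

lemma block_ge_tag: "tag j (R j) i x \<le> block j i x"
proof -
  have "0 \<le> \<bar>shifted j x\<bar> + (- 1) ^ i * shifted j x"
    by (cases "even i") auto
  then show ?thesis by (simp add: block_def)
qed

lemma block_nonneg: "0 \<le> block j i x"
  using tag_nonneg block_ge_tag order_trans by blast

lemma block_in_Lp: "block j i \<in> Lp p"
proof -
  have "(\<lambda>x. tag j (R j) i x + ((1 / 2 ^ R j) * \<bar>shifted j x\<bar> + ((- 1) ^ i / 2 ^ R j) * shifted j x)) \<in> Lp p"
    by (intro Lp_add Lp_scale Lp_abs tag_in_Lp shifted_in_Lp)
  then show ?thesis
    by (simp add: block_def[abs_def] add_divide_distrib)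
qed

text \<open>The signs turn \<open>shifted j\<close> into \<open>alt_avg\<close> times
  \<open>h j - alt_tag j (R j)\<close>; its tag term combines with \<open>tag_sum\<close> to
  \<open>tag_rest\<close>.\<close>

lemma block_sum_eq:
  "block_sum j b x = alt_avg (R j) b * h j x + tag_rest j (R j) b x + avg (R j) b * \<bar>shifted j x\<bar>"
proof -
  have "block_sum j b x = tag_sum j (R j) b x + avg (R j) b * \<bar>shifted j x\<bar> + alt_avg (R j) b * shifted j x"
    by (simp add: block_sum_def block_def tag_sum_def avg_def alt_avg_def distrib_left sum.distrib
        sum_distrib_left sum_distrib_right sum_divide_distrib add_divide_distrib mult_ac)
  then show ?thesis
    by (simp add: tag_rest_def right_diff_distrib)
qed

lemma block_sum_alternating: "block_sum j (\<lambda>i. (- 1) ^ i) x = h j x"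
proof -
  have "alt_avg (R j) (\<lambda>i. (- 1) ^ i) = 1"
    by (simp add: alt_avg_def flip: power_mult_distrib)
  moreover have "avg (R j) (\<lambda>i. (- 1) ^ i) = 0"
    using R_pos[of j] sum_alternating_even[of "2 ^ R j"] by (simp add: avg_def)
  ultimately show ?thesis
    by (simp add: block_sum_eq tag_rest_def alt_tag_def)
qed

text \<open>The block dominates its tag, whose norm is at least the alternating average of a unit
  vector, that is \<open>1 / 2 ^ R j\<close> up to sign.\<close>

lemma nrm_block_pos: "i < 2 ^ R j \<Longrightarrow> 0 < nrm (block j i)"
proof -
  assume i: "i < 2 ^ R j"
  have "tag_sum j (R j) (\<lambda>l. if l = i then 1 else 0) = tag j (R j) i"
    using i by (simp add: tag_sum_def[abs_def] if_distrib[of "\<lambda>a. a * _"] cong: if_cong)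
  moreover have "alt_avg (R j) (\<lambda>l. if l = i then 1 else 0) = (- 1) ^ i / 2 ^ R j"
    using i by (simp add: alt_avg_def if_distrib[of "\<lambda>a. _ * a"] cong: if_cong)
  ultimately have "0 < nrm (tag j (R j) i)"
    using abs_alt_avg_le[of "R j" "\<lambda>l. if l = i then 1 else 0" j]
    by (smt (verit) abs_divide abs_neg_one abs_one divide_pos_pos power_abs power_one zero_less_abs_iff zero_less_one zero_less_power zero_less_divide_iff)
  also have "\<dots> \<le> nrm (block j i)"
    using block_in_Lp tag_in_Lp block_ge_tag tag_nonneg block_nonneg
    by (intro nrm_mono) (auto dest: Lp_measurable)
  finally show ?thesis .
qed

section \<open>Block sums as a main part and a small perturbation\<close>

definition haar_part :: "(nat \<Rightarrow> nat \<Rightarrow> real) \<Rightarrow> nat \<Rightarrow> real \<Rightarrow> real" where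
  "haar_part b J x = (\<Sum>j<J. alt_avg (R j) (b j) * h j x)"

definition tag_part :: "(nat \<Rightarrow> nat \<Rightarrow> real) \<Rightarrow> nat \<Rightarrow> real \<Rightarrow> real" where
  "tag_part b J x = (\<Sum>j<J. tag_rest j (R j) (b j) x)"

definition abs_part :: "(nat \<Rightarrow> nat \<Rightarrow> real) \<Rightarrow> nat \<Rightarrow> real \<Rightarrow> real" where
  "abs_part b J x = (\<Sum>j<J. avg (R j) (b j) * \<bar>shifted j x\<bar>)"

lemma parts_in_Lp: "haar_part b J \<in> Lp p" "tag_part b J \<in> Lp p" "abs_part b J \<in> Lp p"
  unfolding haar_part_def[abs_def] tag_part_def[abs_def] abs_part_def[abs_def]
  by (intro Lp_sum Lp_scale Lp_abs h_in_Lp tag_rest_in_Lp shifted_in_Lp)+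

lemma block_sums_eq: "(\<Sum>j<J. block_sum j (b j) x) = haar_part b J x + tag_part b J x + abs_part b J x"
  by (simp add: haar_part_def tag_part_def abs_part_def block_sum_eq sum.distrib)

abbreviation main_nrm :: "(nat \<Rightarrow> nat \<Rightarrow> real) \<Rightarrow> nat \<Rightarrow> real" where
  "main_nrm b J \<equiv> nrm (\<lambda>x. haar_part b J x + tag_part b J x)"

lemma haar_or_tag_part_eq_0: "haar_part b J x = 0 \<or> tag_part b' J' x = 0"
  using h_eq_0 tag_rest_eq_0 by (cases "x < 1") (auto simp: haar_part_def tag_part_def)

lemma main_in_Lp: "(\<lambda>x. haar_part b J x + tag_part b J x) \<in> Lp p"
  by (intro Lp_add parts_in_Lp)

lemma haar_part_le:
  assumes "j \<le> J" shows "nrm (haar_part b j) \<le> main_nrm b J"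
proof -
  have "nrm (haar_part b j) \<le> nrm (haar_part b J)"
    unfolding haar_part_def[abs_def] by (rule h_monotone[OF assms])
  also have "\<dots> \<le> main_nrm b J"
  proof (rule nrm_mono[OF main_in_Lp])
    show "\<bar>haar_part b J x\<bar> \<le> \<bar>haar_part b J x + tag_part b J x\<bar>" for x
      using haar_or_tag_part_eq_0[of b J x b J] by auto
  qed (use parts_in_Lp Lp_measurable in blast)
  finally show ?thesis .
qed

text \<open>Arbitrary index sets are allowed in order to cover both initial segments and single
  blocks.\<close>

lemma sub_tag_part_le:
  assumes "T \<subseteq> {..<J}"
  shows "nrm (\<lambda>x. \<Sum>j\<in>T. tag_rest j (R j) (b j) x) \<le> main_nrm b J"
proof -
  have "nrm (\<lambda>x. \<Sum>j\<in>T. tag_rest j (R j) (b j) x) \<le> nrm (tag_part b J)"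
  proof (rule nrm_mono[OF parts_in_Lp(2)])
    show "(\<lambda>x. \<Sum>j\<in>T. tag_rest j (R j) (b j) x) \<in> borel_measurable borel"
      by (rule Lp_measurable) (intro Lp_sum tag_rest_in_Lp)
    show "\<bar>\<Sum>j\<in>T. tag_rest j (R j) (b j) x\<bar> \<le> \<bar>tag_part b J x\<bar>" for x
      unfolding tag_part_def using assms tag_rest_disjoint by (intro abs_le_abs_sum_disjoint) auto
  qed
  also have "\<dots> \<le> main_nrm b J"
  proof (rule nrm_mono[OF main_in_Lp])
    show "\<bar>tag_part b J x\<bar> \<le> \<bar>haar_part b J x + tag_part b J x\<bar>" for x
      using haar_or_tag_part_eq_0[of b J x b J] by auto
  qed (use parts_in_Lp Lp_measurable in blast)
  finally show ?thesis .
qed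

lemma tag_part_le: "j \<le> J \<Longrightarrow> nrm (tag_part b j) \<le> main_nrm b J"
  using sub_tag_part_le[of "{..<j}" J b] by (simp add: tag_part_def[abs_def])

lemma tag_rest_le: "j < J \<Longrightarrow> nrm (tag_rest j (R j) (b j)) \<le> main_nrm b J"
  using sub_tag_part_le[of "{j}" J b] by simp

text \<open>\<open>h j\<close> has norm 1, so the coefficient is the norm of a difference of two
  partial sums of a monotone basis.\<close>

lemma alt_avg_le:
  assumes "j < J" shows "\<bar>alt_avg (R j) (b j)\<bar> \<le> 2 * main_nrm b J"
proof -
  have "\<bar>alt_avg (R j) (b j)\<bar> = nrm (\<lambda>x. haar_part b (Suc j) x - haar_part b j x)"
    by (simp add: haar_part_def nrm_h)
  also have "\<dots> \<le> nrm (haar_part b (Suc j)) + nrm (haar_part b j)"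
    by (intro nrm_triangle_minus parts_in_Lp)
  also have "\<dots> \<le> 2 * main_nrm b J"
    using haar_part_le[of "Suc j" J b] haar_part_le[of j J b] assms by simp
  finally show ?thesis .
qed

lemma avg_le: "\<bar>avg (R j) b\<bar> \<le> 1 / 2 ^ (j + 3) * nrm (tag_rest j (R j) b)"
  using abs_avg_le[OF R_pos, of j b j] mult_right_mono[OF R_large[of j], of "nrm (tag_rest j (R j) b)"]
  by simp

lemma abs_part_le:
  assumes "j \<le> J" shows "nrm (abs_part b j) \<le> main_nrm b J / 2"
proof -
  have geo: "(\<Sum>i<j. 2 * (1 / 2 ^ (i + 3))) \<le> (1 / 2 :: real)" for j
  proof -
    have "(\<Sum>i<j. 2 * (1 / 2 ^ (i + 3)) :: real) = 1 / 4 * (\<Sum>i<j. (1 / 2) ^ i)"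
      unfolding sum_distrib_left by (intro sum.cong refl) (simp add: power_add power_divide)
    moreover have "(\<Sum>i<j. (1 / 2) ^ i) \<le> (2 :: real)"
      using zero_le_power[of "1 / 2 :: real" j] by (simp add: sum_gp_strict)
    ultimately show ?thesis by linarith
  qed
  have "nrm (abs_part b j) \<le> (\<Sum>i<j. nrm (\<lambda>x. avg (R i) (b i) * \<bar>shifted i x\<bar>))"
    unfolding abs_part_def[abs_def] by (intro nrm_sum Lp_scale Lp_abs shifted_in_Lp)
  also have "\<dots> \<le> (\<Sum>i<j. 2 * (1 / 2 ^ (i + 3)) * main_nrm b J)"
  proof (rule sum_mono)
    fix i assume "i \<in> {..<j}"
    then have "\<bar>avg (R i) (b i)\<bar> \<le> 1 / 2 ^ (i + 3) * main_nrm b J"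
      using avg_le[of i "b i"] assms
        mult_left_mono[OF tag_rest_le[of i J b], of "1 / 2 ^ (i + 3)"] by simp
    then have "\<bar>avg (R i) (b i)\<bar> * nrm (shifted i) \<le> 1 / 2 ^ (i + 3) * main_nrm b J * 2"
      using nrm_shifted by (intro mult_mono) auto
    then show "nrm (\<lambda>x. avg (R i) (b i) * \<bar>shifted i x\<bar>) \<le> 2 * (1 / 2 ^ (i + 3)) * main_nrm b J"
      by (simp add: mult.commute)
  qed
  also have "\<dots> \<le> 1 / 2 * main_nrm b J"
    unfolding sum_distrib_right[symmetric] using geo by (intro mult_right_mono) auto
  finally show ?thesis by simp
qed

text \<open>The perturbation is at most half of the main part, so it cannot cancel more than half of
  it.\<close>

lemma main_nrm_le: "main_nrm b J \<le> 2 * nrm (\<lambda>x. \<Sum>j<J. block_sum j (b j) x)"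
proof -
  have "main_nrm b J - nrm (\<lambda>x. - 1 * abs_part b J x)
      \<le> nrm (\<lambda>x. (haar_part b J x + tag_part b J x) - - 1 * abs_part b J x)"
    by (intro nrm_diff_ge main_in_Lp Lp_scale parts_in_Lp)
  then show ?thesis
    unfolding block_sums_eq using abs_part_le[of J J b] by simp
qed

lemma truncated_sum_le:
  obtains K where
    "\<And>J j k b. j < J \<Longrightarrow> k \<le> 2 ^ R j \<Longrightarrow>
       nrm (\<lambda>x. (\<Sum>l<j. block_sum l (b l) x) + block_sum j (\<lambda>i. if i < k then b j i else 0) x)
         \<le> K * nrm (\<lambda>x. \<Sum>l<J. block_sum l (b l) x)"
proof -
  obtain K where K: "0 \<le> K"
    "\<And>j R k b. k \<le> 2 ^ R \<Longrightarrow> nrm (tag_sum j R (\<lambda>i. if i < k then b i else 0)) \<le> K * nrm (tag_sum j R b)"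
    using nrm_tag_sum_truncate by blast
  have "nrm (\<lambda>x. (\<Sum>l<j. block_sum l (b l) x) + block_sum j (\<lambda>i. if i < k then b j i else 0) x)
      \<le> (5 + 24 * K) * nrm (\<lambda>x. \<Sum>l<J. block_sum l (b l) x)"
    if j: "j < J" and k: "k \<le> 2 ^ R j" for J j k b
  proof -
    define D where "D = main_nrm b J"
    define t where "t = (\<lambda>i. if i < k then b j i else 0)"
    \<comment> \<open>The cut block is measured by its tags alone: each of the three components of
      \<open>block_sum j t\<close> is bounded by a multiple of \<tau>.\<close>
    define \<tau> where "\<tau> = nrm (tag_sum j (R j) t)"
    have "0 \<le> D" by (simp add: D_def)
    have "\<tau> \<le> K * nrm (tag_sum j (R j) (b j))"
      unfolding \<tau>_def t_def by (rule K(2)[OF k])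
    \<comment> \<open>One \<open>D\<close> for \<open>tag_rest\<close> and two for the alternating
      average.\<close>
    also have "\<dots> \<le> K * (3 * D)"
      using nrm_tag_sum_le_rest[of j "R j" "b j"] tag_rest_le[OF j, of b] alt_avg_le[OF j, of b] K(1)
      by (intro mult_left_mono) (simp_all add: D_def)
    finally have \<tau>: "\<tau> \<le> 3 * K * D"
      by (simp add: mult_ac)
    have rest: "nrm (tag_rest j (R j) t) \<le> 2 * \<tau>"
      unfolding \<tau>_def by (rule nrm_tag_rest_le)
    \<comment> \<open>Since j + 3 \<ge> 3, the plain average is damped by 1/8 in every block, which
      outweighs the factors 2 from \<open>rest\<close> and \<open>nrm_shifted\<close>.\<close>
    have "(2::real) ^ 3 \<le> 2 ^ (j + 3)"
      by (rule power_increasing) auto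
    then have "1 / 2 ^ (j + 3) \<le> (1 / 8 :: real)"
      by (intro frac_le) auto
    then have "1 / 2 ^ (j + 3) * nrm (tag_rest j (R j) t) \<le> 1 / 8 * (2 * \<tau>)"
      using rest by (intro mult_mono) auto
    then have "\<bar>avg (R j) t\<bar> \<le> 1 / 8 * (2 * \<tau>)"
      by (rule order_trans[OF avg_le])
    then have "\<bar>avg (R j) t\<bar> * nrm (shifted j) \<le> 1 / 8 * (2 * \<tau>) * 2"
      using nrm_shifted by (intro mult_mono) (auto simp: \<tau>_def)
    then have abs: "nrm (\<lambda>x. avg (R j) t * \<bar>shifted j x\<bar>) \<le> \<tau>"
      using nrm_nonneg[of "tag_sum j (R j) t"] unfolding \<tau>_def nrm_scale nrm_abs by linarith
    have haar: "nrm (\<lambda>x. alt_avg (R j) t * h j x) \<le> \<tau>"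
      using abs_alt_avg_le[of "R j" t j] by (simp add: nrm_h \<tau>_def)
    have "nrm (\<lambda>x. (\<Sum>l<j. block_sum l (b l) x) + block_sum j t x) =
        nrm (\<lambda>x. (haar_part b j x + tag_part b j x + abs_part b j x)
          + (alt_avg (R j) t * h j x + tag_rest j (R j) t x + avg (R j) t * \<bar>shifted j x\<bar>))"
      by (simp only: block_sums_eq block_sum_eq[of j t])
    also have "\<dots> \<le> (nrm (haar_part b j) + nrm (tag_part b j) + nrm (abs_part b j))
        + (nrm (\<lambda>x. alt_avg (R j) t * h j x) + nrm (tag_rest j (R j) t) + nrm (\<lambda>x. avg (R j) t * \<bar>shifted j x\<bar>))"
    proof (rule order_trans[OF nrm_triangle add_mono])
      show "nrm (\<lambda>x. haar_part b j x + tag_part b j x + abs_part b j x)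
          \<le> nrm (haar_part b j) + nrm (tag_part b j) + nrm (abs_part b j)"
        by (intro nrm_triangle3 parts_in_Lp)
      show "nrm (\<lambda>x. alt_avg (R j) t * h j x + tag_rest j (R j) t x + avg (R j) t * \<bar>shifted j x\<bar>)
          \<le> nrm (\<lambda>x. alt_avg (R j) t * h j x) + nrm (tag_rest j (R j) t) + nrm (\<lambda>x. avg (R j) t * \<bar>shifted j x\<bar>)"
        by (intro nrm_triangle3 Lp_scale Lp_abs h_in_Lp tag_rest_in_Lp shifted_in_Lp)
    qed (intro Lp_add Lp_scale Lp_abs parts_in_Lp h_in_Lp tag_rest_in_Lp shifted_in_Lp)+
    also have "\<dots> \<le> (D + D + D / 2) + (\<tau> + 2 * \<tau> + \<tau>)"
      using haar_part_le[of j J b] tag_part_le[of j J b] abs_part_le[of j J b] j rest abs haar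
      unfolding D_def by linarith
    also have "\<dots> \<le> (5 / 2 + 12 * K) * D"
      using \<tau> by (simp add: algebra_simps)
    also have "\<dots> \<le> (5 / 2 + 12 * K) * (2 * nrm (\<lambda>x. \<Sum>l<J. block_sum l (b l) x))"
      unfolding D_def using K(1) by (intro mult_left_mono main_nrm_le) auto
    finally show ?thesis
      by (simp add: t_def algebra_simps)
  qed
  then show ?thesis by (rule that)
qed

section \<open>Enumeration of the blocks as a single sequence\<close>

definition start :: "nat \<Rightarrow> nat" where
  "start j = (\<Sum>l<j. 2 ^ R l)"

definition block_of :: "nat \<Rightarrow> nat" where
  "block_of n = (LEAST j. n < start (Suc j))"

definition system :: "nat \<Rightarrow> real \<Rightarrow> real" where
  "system n = block (block_of n) (n - start (block_of n))"

lemma start_Suc: "start (Suc j) = start j + 2 ^ R j"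
  by (simp add: start_def)

lemma start_mono: "j \<le> k \<Longrightarrow> start j \<le> start k"
  unfolding start_def by (intro sum_mono2) auto

lemma le_start: "j \<le> start j"
proof (induction j)
  case (Suc j)
  have "(1::nat) \<le> 2 ^ R j" by simp
  with Suc show ?case by (simp only: start_Suc)
qed simp

lemma block_of_eq: "i < 2 ^ R j \<Longrightarrow> block_of (start j + i) = j"
  unfolding block_of_def
proof (rule Least_equality)
  fix k assume "start j + i < start (Suc k)"
  then show "j \<le> k"
    using start_mono[of "Suc k" j] by (cases "j \<le> k") auto
qed (simp add: start_Suc)

lemma system_start: "i < 2 ^ R j \<Longrightarrow> system (start j + i) = block j i"
  by (simp add: system_def block_of_eq)

lemma block_index: obtains j i where "n = start j + i" "i < 2 ^ R j"
proof -
  have ex: "\<exists>j. n < start (Suc j)"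
    using le_start[of "Suc n"] by (intro exI[of _ n]) simp
  define j where "j = (LEAST j. n < start (Suc j))"
  have "n < start (Suc j)"
    unfolding j_def using ex by (rule LeastI_ex)
  moreover have "start j \<le> n"
  proof (cases j)
    case (Suc i)
    then show ?thesis
      using not_less_Least[of i "\<lambda>j. n < start (Suc j)"] by (simp add: j_def)
  qed (simp add: start_def)
  ultimately show ?thesis
    by (intro that[of j "n - start j"]) (auto simp: start_Suc)
qed

lemma sum_system:
  "(\<Sum>n<start J. c n * system n x) = (\<Sum>j<J. block_sum j (\<lambda>i. c (start j + i)) x)"
proof (induction J)
  case (Suc J)
  then show ?case
    by (simp add: start_Suc sum_lessThan_add block_sum_def system_start)
qed (simp add: start_def)

lemma sum_system_truncated:
  assumes "k \<le> 2 ^ R j"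
  shows "(\<Sum>n<start j + k. c n * system n x) =
    (\<Sum>l<j. block_sum l (\<lambda>i. c (start l + i)) x) + block_sum j (\<lambda>i. if i < k then c (start j + i) else 0) x"
  using assms by (simp add: sum_lessThan_add sum_system block_sum_def sum_pad system_start)

lemma system_nonneg: "0 \<le> system n x"
  by (simp add: system_def block_nonneg)

lemma system_in_Lp: "system n \<in> Lp p"
  by (simp add: system_def block_in_Lp)

lemma schauder_basic_system: "schauder_basic p system"
proof -
  obtain K where K: "\<And>J j k b. j < J \<Longrightarrow> k \<le> 2 ^ R j \<Longrightarrow>
       nrm (\<lambda>x. (\<Sum>l<j. block_sum l (b l) x) + block_sum j (\<lambda>i. if i < k then b j i else 0) x)
         \<le> K * nrm (\<lambda>x. \<Sum>l<J. block_sum l (b l) x)"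
    using truncated_sum_le by blast
  show ?thesis
  proof (rule Grunblum_criterion)
    show "0 < nrm (system n)" for n
      by (rule block_index[of n]) (simp add: system_start nrm_block_pos)
    fix c :: "nat \<Rightarrow> real" and m n :: nat
    assume "m \<le> n"
    obtain j k where jk: "m = start j + k" "k < 2 ^ R j"
      by (rule block_index)
    \<comment> \<open>Cutting at \<open>n\<close> allows the longer sum to be filled up to complete
      blocks; the first \<open>m\<close> coefficients are unaffected.\<close>
    define c' where "c' i = (if i < n then c i else 0)" for i
    \<comment> \<open>Large enough for both \<open>j < J\<close> and \<open>n \<le> start J\<close>,
      as \<open>le_start\<close> shows.\<close>
    define J where "J = Suc (max n j)"
    have "n \<le> start J"
      using le_start[of J] by (simp add: J_def)
    then have n: "(\<Sum>i<n. c i * system i x) = (\<Sum>l<J. block_sum l (\<lambda>i. c' (start l + i)) x)" for x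
      using sum_system[of c' x J] sum_pad[of n "start J" c "\<lambda>i. system i x"] by (simp add: c'_def)
    have "(\<Sum>i<m. c i * system i x) = (\<Sum>i<m. c' i * system i x)" for x
      using \<open>m \<le> n\<close> by (intro sum.cong) (auto simp: c'_def)
    then show "nrm (\<lambda>x. \<Sum>i<m. c i * system i x) \<le> K * nrm (\<lambda>x. \<Sum>i<n. c i * system i x)"
      unfolding n jk(1) using jk(2) K[of j J k "\<lambda>l i. c' (start l + i)"]
      by (simp add: sum_system_truncated J_def)
  qed (rule system_in_Lp)
qed

lemma h_in_closed_span: "h j \<in> closed_span p system"
proof -
  define c where "c n = (if start j \<le> n then (- 1) ^ (n - start j) else 0 :: real)" for n
  have "(\<Sum>n<start (Suc j). c n * system n x) = h j x" for x
  proof -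
    have "(\<Sum>n<start (Suc j). c n * system n x) = (\<Sum>i<2 ^ R j. (- 1) ^ i * block j i x)"
      by (simp add: start_Suc sum_lessThan_add system_start c_def)
    then show ?thesis
      using block_sum_alternating[of j x] by (simp add: block_sum_def)
  qed
  then have "h j = (\<lambda>x. \<Sum>n<start (Suc j). c n * system n x)"
    by auto
  then show ?thesis
    using lincomb_in_closed_span[OF system_in_Lp] by simp
qed

end

section \<open>The Haar basis\<close>

text \<open>With half-open intervals each level partitions \<open>{0..<1}\<close> exactly, so the
  identities below hold at every point.\<close>

definition dyadic :: "nat \<Rightarrow> nat \<Rightarrow> real set" where
  "dyadic n k = {real k / 2 ^ n..<(real k + 1) / 2 ^ n}"

lemma mem_dyadic: "x \<in> dyadic n k \<longleftrightarrow> real k \<le> x * 2 ^ n \<and> x * 2 ^ n < real k + 1"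
  by (auto simp: dyadic_def field_simps)

lemma dyadic_measurable [measurable, simp]: "dyadic n k \<in> sets borel"
  by (simp add: dyadic_def)

lemma emeasure_dyadic: "emeasure lborel (dyadic n k) = ennreal (1 / 2 ^ n)"
  by (simp add: dyadic_def divide_right_mono flip: diff_divide_distrib)

lemma measure_dyadic: "measure lborel (dyadic n k) = 1 / 2 ^ n"
  by (simp add: measure_def emeasure_dyadic)

lemma dyadic_unique:
  assumes "x \<in> dyadic n k" "x \<in> dyadic n l" shows "k = l"
proof -
  have "real k < real l + 1" "real l < real k + 1"
    using assms unfolding mem_dyadic by linarith+
  then show ?thesis by linarith
qed

lemma dyadic_ancestor:
  assumes "x \<in> dyadic (n + d) k" shows "x \<in> dyadic n (k div 2 ^ d)"
proof -
  define q r where "q = k div 2 ^ d" and "r = k mod 2 ^ d"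
  have k: "k = q * 2 ^ d + r"
    by (simp only: q_def r_def div_mult_mod_eq)
  have "r < 2 ^ d"
    by (simp add: r_def)
  \<comment> \<open>In the reals r < 2^d would be too weak: the right end needs the integer form r +
    1 \<le> 2^d.\<close>
  then have "real (r + 1) \<le> real (2 ^ d)"
    unfolding of_nat_le_iff by simp
  then have "real r + 1 \<le> 2 ^ d"
    by simp
  moreover have "real q * 2 ^ d + real r \<le> x * 2 ^ n * 2 ^ d" "x * 2 ^ n * 2 ^ d < real q * 2 ^ d + real r + 1"
    using assms by (simp_all add: mem_dyadic k power_add mult.assoc)
  ultimately have "real q * 2 ^ d \<le> x * 2 ^ n * 2 ^ d" "x * 2 ^ n * 2 ^ d < (real q + 1) * 2 ^ d"
    unfolding distrib_right mult_1 by linarith+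
  then show ?thesis
    unfolding q_def[symmetric] mem_dyadic by simp
qed

lemma dyadic_ancestor_iff:
  assumes "x \<in> dyadic n k" "r \<le> n" shows "x \<in> dyadic r l \<longleftrightarrow> l = k div 2 ^ (n - r)"
  using dyadic_ancestor[of x r "n - r" k] assms dyadic_unique by auto

lemma mem_dyadic_Suc:
  "x \<in> dyadic n k \<longleftrightarrow> x \<in> dyadic (Suc n) (2 * k) \<or> x \<in> dyadic (Suc n) (2 * k + 1)"
proof -
  define t where "t = x * 2 ^ n"
  have t: "x * 2 ^ Suc n = 2 * t"
    by (simp add: t_def)
  show ?thesis
    unfolding mem_dyadic t t_def[symmetric] by (simp, linarith)
qed

lemma dyadic_children_disjoint: "x \<in> dyadic (Suc n) (2 * k) \<Longrightarrow> x \<notin> dyadic (Suc n) (2 * k + 1)"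
  using dyadic_unique[of x "Suc n" "2 * k" "2 * k + 1"] by auto

lemma dyadic_subset_unit:
  assumes "x \<in> dyadic n k" "k < 2 ^ n" shows "0 \<le> x" "x < 1"
proof -
  have "x \<in> dyadic 0 (k div 2 ^ n)"
    using dyadic_ancestor[of x 0 n k] assms by simp
  then have "x \<in> dyadic 0 0"
    using assms by simp
  then show "0 \<le> x" "x < 1"
    by (auto simp: mem_dyadic)
qed

lemma ex_dyadic:
  assumes "0 \<le> x" "x < 1" shows "\<exists>k<2 ^ n. x \<in> dyadic n k"
proof (induction n)
  case 0
  then show ?case using assms by (auto simp: mem_dyadic)
next
  case (Suc n)
  then obtain k where k: "k < 2 ^ n" "x \<in> dyadic n k" by blast
  then have "2 * k < 2 ^ Suc n" "2 * k + 1 < 2 ^ Suc n" by auto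
  then show ?case using k(2) unfolding mem_dyadic_Suc[of x n k] by blast
qed

text \<open>The index \<open>2 ^ n + k\<close> belongs to the k-th interval of level
  \<open>n\<close>. Without normalisation the absolute value is an indicator.\<close>

definition haar :: "nat \<Rightarrow> real \<Rightarrow> real" where
  "haar j = (if j = 0 then indicat_real (dyadic 0 0) else
     let n = floor_log j; k = j - 2 ^ n in
       (\<lambda>x. indicat_real (dyadic (Suc n) (2 * k)) x - indicat_real (dyadic (Suc n) (2 * k + 1)) x))"

lemma haar_0: "haar 0 = indicat_real (dyadic 0 0)"
  by (simp add: haar_def)

lemma haar_eq:
  assumes "k < 2 ^ n"
  shows "haar (2 ^ n + k) = (\<lambda>x. indicat_real (dyadic (Suc n) (2 * k)) x - indicat_real (dyadic (Suc n) (2 * k + 1)) x)"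
proof -
  have "floor_log (2 ^ n + k) = n"
    using assms by (intro floor_log_eqI) auto
  then show ?thesis by (simp add: haar_def Let_def)
qed

lemma haar_index:
  fixes j :: nat
  assumes "0 < j" obtains n k where "j = 2 ^ n + k" "k < 2 ^ n"
  using floor_log_exp2_le[OF assms] floor_log_exp2_gt[of j]
  by (intro that[of "floor_log j" "j - 2 ^ floor_log j"]) auto

lemma abs_haar_eq: "k < 2 ^ n \<Longrightarrow> \<bar>haar (2 ^ n + k) x\<bar> = indicat_real (dyadic n k) x"
  using mem_dyadic_Suc[of x n k] dyadic_children_disjoint[of x n k]
  by (auto simp: haar_eq indicator_def)

lemma abs_haar: "\<exists>n k. k < 2 ^ n \<and> (\<forall>x. \<bar>haar j x\<bar> = indicat_real (dyadic n k) x)"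
proof (cases "j = 0")
  case True
  then show ?thesis by (intro exI[of _ 0]) (simp add: haar_0)
next
  case False
  then obtain n k where "j = 2 ^ n + k" "k < 2 ^ n"
    using haar_index[of j] by auto
  then show ?thesis using abs_haar_eq by blast
qed

lemma haar_eq_0: "1 \<le> x \<Longrightarrow> haar j x = 0"
proof -
  obtain n k where nk: "k < 2 ^ n" "\<bar>haar j x\<bar> = indicat_real (dyadic n k) x"
    using abs_haar by blast
  show "haar j x = 0" if "1 \<le> x"
  proof -
    have "x \<notin> dyadic n k"
      using dyadic_subset_unit(2)[of x n k] nk(1) that by auto
    then show ?thesis using nk(2) by simp
  qed
qed

lemma haar_measurable [measurable]: "haar j \<in> borel_measurable borel"
  by (auto simp: haar_def Let_def intro!: borel_measurable_diff)

text \<open>An earlier function is either of a coarser level, hence constant on intervals of level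
  \<open>n\<close>, or of the same level with a disjoint support.\<close>

lemma haar_constant:
  assumes k: "k < 2 ^ n" and i: "i < 2 ^ n + k" and x: "x \<in> dyadic n k" and y: "y \<in> dyadic n k"
  shows "haar i x = haar i y"
proof (cases "i = 0")
  case True
  then show ?thesis
    using dyadic_ancestor_iff[OF x, of 0] dyadic_ancestor_iff[OF y, of 0] by (simp add: haar_0 indicator_def)
next
  case False
  then obtain r l where rl: "i = 2 ^ r + l" "l < 2 ^ r"
    using haar_index[of i] by auto
  show ?thesis
  proof (cases "r < n")
    case True
    then show ?thesis
      using dyadic_ancestor_iff[OF x, of "Suc r"] dyadic_ancestor_iff[OF y, of "Suc r"]
      by (simp add: rl haar_eq indicator_def)
  next
    case False
    have "r = n"
    proof (rule ccontr)
      assume "r \<noteq> n"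
      then have "(2::nat) ^ Suc n \<le> 2 ^ r"
        using False by (intro power_increasing) auto
      then show False using i k rl by simp
    qed
    then have "l \<noteq> k" using i rl by simp
    then have "x \<notin> dyadic n l" "y \<notin> dyadic n l"
      using x y dyadic_unique by blast+
    then have "\<bar>haar i x\<bar> = 0" "\<bar>haar i y\<bar> = 0"
      using abs_haar_eq[OF rl(2)] rl(1) \<open>r = n\<close> by simp_all
    then show ?thesis by simp
  qed
qed

section \<open>Monotonicity and density of the Haar functions in L_p of the unit interval\<close>

context lp_space
begin

lemma closed_span_lim:
  assumes "f \<in> Lp p" "\<And>j. z j \<in> Lp p" "\<And>n::nat. s n \<in> closed_span p z"
    and "(\<lambda>n. nrm (\<lambda>x. s n x - f x)) \<longlonglongrightarrow> 0"
  shows "f \<in> closed_span p z"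
proof (rule closed_span_closed[OF assms(1,2)])
  fix e :: real assume "0 < e"
  then obtain n where "nrm (\<lambda>x. s n x - f x) < e"
    using order_tendstoD(2)[OF assms(4)] by (auto simp: eventually_sequentially)
  then show "\<exists>g\<in>closed_span p z. nrm (\<lambda>x. f x - g x) < e"
    by (intro bexI[OF _ assms(3)[of n]]) (simp add: nrm_minus_commute[of f])
qed

lemma dyadic_in_Lp [intro]: "indicat_real (dyadic n k) \<in> Lp p"
  by (rule Lp_indicator) (auto simp: emeasure_dyadic)

lemma haar_in_Lp [intro]: "haar j \<in> Lp p"
proof -
  obtain n k where "\<forall>x. \<bar>haar j x\<bar> = indicat_real (dyadic n k) x"
    using abs_haar by blast
  then show ?thesis
    by (intro Lp_bound[OF dyadic_in_Lp[of n k]]) auto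
qed

lemma nrm_haar_pos: "0 < nrm (haar j)"
proof -
  obtain n k where "\<forall>x. \<bar>haar j x\<bar> = indicat_real (dyadic n k) x"
    using abs_haar by blast
  then have "nrm (haar j) = nrm (indicat_real (dyadic n k))"
    using nrm_abs[of "haar j"] by simp
  moreover have "nrm (indicat_real (dyadic n k)) powr p = 1 / 2 ^ n"
    by (simp add: nrm_powr_indicator measure_dyadic)
  ultimately have "nrm (haar j) \<noteq> 0"
    using p_gt_1 by (metis divide_eq_0_iff powr_0 power_not_zero zero_neq_numeral zero_neq_one)
  then show ?thesis
    using nrm_nonneg[of "haar j"] by linarith
qed

text \<open>The earlier functions are constant on the support of \<open>haar m\<close>, whose two halves carry the
  values \<open>1\<close> and \<open>- 1\<close>; so \<open>y + a haar m\<close> and \<open>y - a haar m\<close> have the same norm.\<close>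

lemma haar_monotone_step:
  fixes a :: "nat \<Rightarrow> real"
  shows "nrm (\<lambda>x. \<Sum>i<m. a i * haar i x) \<le> nrm (\<lambda>x. \<Sum>i<Suc m. a i * haar i x)"
proof (cases "m = 0")
  case False
  then obtain n k where m: "m = 2 ^ n + k" "k < 2 ^ n"
    using haar_index[of m] by auto
  define y where "y = (\<lambda>x. \<Sum>i<m. a i * haar i x)"
  have y: "y \<in> Lp p" unfolding y_def by (intro Lp_sum Lp_scale haar_in_Lp)
  define L where "L = indicat_real (dyadic (Suc n) (2 * k))"
  define U where "U = indicat_real (dyadic (Suc n) (2 * k + 1))"
  define c where "c = y (real k / 2 ^ n)"
  have x0: "real k / 2 ^ n \<in> dyadic n k" by (simp add: mem_dyadic)
  have c: "y x = c" if x: "x \<in> dyadic n k" for x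
    unfolding c_def y_def
  proof (rule sum.cong[OF refl])
    fix i assume "i \<in> {..<m}"
    then have "i < 2 ^ n + k" by (simp add: m(1))
    from haar_constant[OF m(2) this x x0]
    show "a i * haar i x = a i * haar i (real k / 2 ^ n)" by simp
  qed
  have int: "integrable lborel L" "integrable lborel U"
    unfolding L_def U_def by (simp_all add: integrable_real_indicator emeasure_dyadic)
  \<comment> \<open>On the support of \<open>haar m\<close> the function \<open>y\<close> is the
    constant \<open>c\<close>; the two halves have equal measure, so the right side is even in
    \<open>b\<close>.\<close>
  have val: "nrm (\<lambda>x. y x + b * haar m x) powr p =
      (\<integral>x. \<bar>y x\<bar> powr p \<partial>lborel) +
        ((\<bar>c + b\<bar> powr p - \<bar>c\<bar> powr p) * (1 / 2 ^ Suc n) + (\<bar>c - b\<bar> powr p - \<bar>c\<bar> powr p) * (1 / 2 ^ Suc n))" for b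
  proof -
    have "\<bar>y x + b * haar m x\<bar> powr p =
        \<bar>y x\<bar> powr p + ((\<bar>c + b\<bar> powr p - \<bar>c\<bar> powr p) * L x + (\<bar>c - b\<bar> powr p - \<bar>c\<bar> powr p) * U x)" for x
    proof (cases "x \<in> dyadic n k")
      case True
      then show ?thesis
        using c[of x] mem_dyadic_Suc[of x n k] dyadic_children_disjoint[of x n k]
        by (auto simp: m haar_eq L_def U_def indicator_def)
    next
      case False
      then show ?thesis
        using mem_dyadic_Suc[of x n k] by (simp add: m haar_eq L_def U_def indicator_def)
    qed
    then have "nrm (\<lambda>x. y x + b * haar m x) powr p = (\<integral>x. \<bar>y x\<bar> powr p +
        ((\<bar>c + b\<bar> powr p - \<bar>c\<bar> powr p) * L x + (\<bar>c - b\<bar> powr p - \<bar>c\<bar> powr p) * U x) \<partial>lborel)"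
      by (simp add: nrm_powr)
    also have "\<dots> = (\<integral>x. \<bar>y x\<bar> powr p \<partial>lborel) +
        ((\<bar>c + b\<bar> powr p - \<bar>c\<bar> powr p) * (\<integral>x. L x \<partial>lborel) + (\<bar>c - b\<bar> powr p - \<bar>c\<bar> powr p) * (\<integral>x. U x \<partial>lborel))"
      using int Lp_integrable[OF y] by simp
    also have "\<dots> = (\<integral>x. \<bar>y x\<bar> powr p \<partial>lborel) +
        ((\<bar>c + b\<bar> powr p - \<bar>c\<bar> powr p) * (1 / 2 ^ Suc n) + (\<bar>c - b\<bar> powr p - \<bar>c\<bar> powr p) * (1 / 2 ^ Suc n))"
      unfolding L_def U_def by (simp add: measure_dyadic)
    finally show ?thesis .
  qed
  have "nrm (\<lambda>x. y x + - a m * haar m x) powr p = nrm (\<lambda>x. y x + a m * haar m x) powr p"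
    unfolding val by simp
  then have eq: "nrm (\<lambda>x. y x + - a m * haar m x) = nrm (\<lambda>x. y x + a m * haar m x)"
    by (intro order_antisym le_if_powr_le[OF _ nrm_nonneg nrm_nonneg]) auto
  have "nrm (\<lambda>x. 2 * y x) = nrm (\<lambda>x. (y x + a m * haar m x) + (y x + - a m * haar m x))"
    by simp
  also have "\<dots> \<le> nrm (\<lambda>x. y x + a m * haar m x) + nrm (\<lambda>x. y x + - a m * haar m x)"
    by (intro nrm_triangle Lp_add Lp_scale haar_in_Lp y)
  finally have "nrm y \<le> nrm (\<lambda>x. y x + a m * haar m x)"
    unfolding eq by simp
  then show ?thesis
    by (simp add: y_def)
qed simp

definition unit_haar :: "nat \<Rightarrow> real \<Rightarrow> real" where
  "unit_haar j x = 1 / nrm (haar j) * haar j x"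

lemma unit_haar_in_Lp [intro]: "unit_haar j \<in> Lp p"
  unfolding unit_haar_def[abs_def] by (intro Lp_scale haar_in_Lp)

lemma nrm_unit_haar: "nrm (unit_haar j) = 1"
  using nrm_haar_pos[of j] unfolding unit_haar_def[abs_def] nrm_scale by simp

lemma unit_haar_monotone:
  assumes "m \<le> n"
  shows "nrm (\<lambda>x. \<Sum>j<m. a j * unit_haar j x) \<le> nrm (\<lambda>x. \<Sum>j<n. a j * unit_haar j x)"
proof -
  have "nrm (\<lambda>x. \<Sum>j<m. a j / nrm (haar j) * haar j x) \<le> nrm (\<lambda>x. \<Sum>j<n. a j / nrm (haar j) * haar j x)"
    using assms
  proof (induction rule: dec_induct)
    case (step n)
    then show ?case using haar_monotone_step[of "\<lambda>j. a j / nrm (haar j)" n] by linarith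
  qed simp
  then show ?thesis by (simp add: unit_haar_def)
qed

lemma haar_in_closed_span: "haar j \<in> closed_span p unit_haar"
proof -
  have "(\<lambda>x. \<Sum>i<Suc j. (if i = j then nrm (haar j) else 0) * unit_haar i x) = haar j"
    using nrm_haar_pos[of j] by (auto simp: unit_haar_def)
  then show ?thesis
    using lincomb_in_closed_span[of unit_haar "\<lambda>i. if i = j then nrm (haar j) else 0" "Suc j"] unit_haar_in_Lp
    by simp
qed

text \<open>The indicators of the two children are half the sum and half the difference of the
  parent's indicator and its Haar function.\<close>

lemma dyadic_in_closed_span: "k < 2 ^ n \<Longrightarrow> indicat_real (dyadic n k) \<in> closed_span p unit_haar"
proof (induction n arbitrary: k)
  case 0
  then show ?case using haar_in_closed_span[of 0] by (simp add: haar_0)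
next
  case (Suc n)
  define l where "l = k div 2"
  have l: "l < 2 ^ n" using Suc.prems by (auto simp: l_def)
  have span: "(\<lambda>x. 1 / 2 * (indicat_real (dyadic n l) x + s * haar (2 ^ n + l) x)) \<in> closed_span p unit_haar" for s
    using Suc.IH[OF l] by (intro closed_span_scale closed_span_add haar_in_closed_span unit_haar_in_Lp)
  have left: "(\<lambda>x. 1 / 2 * (indicat_real (dyadic n l) x + 1 * haar (2 ^ n + l) x)) = indicat_real (dyadic (Suc n) (2 * l))"
    (is "?lhs = ?rhs")
  proof
    fix x
    show "?lhs x = ?rhs x"
      using mem_dyadic_Suc[of x n l] dyadic_children_disjoint[of x n l] by (auto simp: haar_eq[OF l] indicator_def)
  qed
  have right: "(\<lambda>x. 1 / 2 * (indicat_real (dyadic n l) x + - 1 * haar (2 ^ n + l) x)) = indicat_real (dyadic (Suc n) (2 * l + 1))"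
    (is "?lhs = ?rhs")
  proof
    fix x
    show "?lhs x = ?rhs x"
      using mem_dyadic_Suc[of x n l] dyadic_children_disjoint[of x n l] by (auto simp: haar_eq[OF l] indicator_def)
  qed
  have "k = 2 * l \<or> k = 2 * l + 1" by (auto simp: l_def)
  then show ?case
    using span[of 1] span[of "- 1"] unfolding left right by auto
qed

lemma unit_indicator_in_Lp: "indicat_real {0..<1} \<in> Lp p"
  by (rule Lp_indicator) auto

text \<open>The approximants are step functions that sample \<open>g\<close> at the left endpoints
  of the dyadic intervals.\<close>

lemma continuous_in_closed_span:
  assumes g: "continuous_on UNIV g" and B: "\<And>x. \<bar>g x\<bar> \<le> B"
  shows "(\<lambda>x. g x * indicat_real {0..<1} x) \<in> closed_span p unit_haar"
proof (rule closed_span_lim)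
  have [measurable]: "g \<in> borel_measurable borel"
    using g by (rule borel_measurable_continuous_onI)
  have B0: "0 \<le> B" using B[of 0] by linarith
  define s where "s n x = (\<Sum>k<2 ^ n. g (real k / 2 ^ n) * indicat_real (dyadic n k) x)" for n x
  have s_val: "s n x = g (real k / 2 ^ n)" if "x \<in> dyadic n k" "k < 2 ^ n" for n x k
  proof -
    have "indicat_real (dyadic n l) x = (if l = k then 1 else 0)" for l
      using that(1) dyadic_unique by (auto simp: indicator_def)
    then show ?thesis using that(2) by (simp add: s_def if_distrib[of "\<lambda>a. _ * a"] cong: if_cong)
  qed
  have s_out: "s n x = 0" if "x \<notin> {0..<1}" for n x
    unfolding s_def using that dyadic_subset_unit[of x n] by (intro sum.neutral) (auto simp: indicator_def)
  show s_span: "s n \<in> closed_span p unit_haar" for n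
    unfolding s_def[abs_def]
    by (intro closed_span_sum closed_span_scale dyadic_in_closed_span unit_haar_in_Lp) auto
  have bound_Lp: "(\<lambda>x. 2 * B * indicat_real {0..<1} x) \<in> Lp p"
    by (intro Lp_scale unit_indicator_in_Lp)
  show "(\<lambda>x. g x * indicat_real {0..<1} x) \<in> Lp p"
    using B B0 order_trans[OF B, of "2 * B"] by (intro Lp_bound[OF bound_Lp]) (auto simp: indicator_def)
  show "(\<lambda>n. nrm (\<lambda>x. s n x - g x * indicat_real {0..<1} x)) \<longlonglongrightarrow> 0"
  proof (rule nrm_lim_dominated[OF bound_Lp])
    show "AE x in lborel. (\<lambda>n. s n x) \<longlonglongrightarrow> g x * indicat_real {0..<1} x"
    proof (rule AE_I2)
      fix x :: real
      show "(\<lambda>n. s n x) \<longlonglongrightarrow> g x * indicat_real {0..<1} x"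
      proof (cases "x \<in> {0..<1}")
        case True
        then have "\<forall>n. \<exists>k<2 ^ n. x \<in> dyadic n k" using ex_dyadic by auto
        then obtain k where k: "\<And>n. k n < 2 ^ n" "\<And>n. x \<in> dyadic n (k n)" by metis
        have sandwich: "real (k n) / 2 ^ n \<le> x" "x - (1 / 2) ^ n \<le> real (k n) / 2 ^ n" for n
        proof -
          have "real (k n) \<le> x * 2 ^ n" "x * 2 ^ n \<le> real (k n) + 1"
            using k(2)[of n] by (auto simp: mem_dyadic)
          then have "real (k n) / 2 ^ n \<le> x" "x \<le> (real (k n) + 1) / 2 ^ n"
            by (simp_all add: pos_divide_le_eq pos_le_divide_eq)
          then show "real (k n) / 2 ^ n \<le> x" "x - (1 / 2) ^ n \<le> real (k n) / 2 ^ n"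
            by (simp_all add: add_divide_distrib power_divide)
        qed
        have "(\<lambda>n. real (k n) / 2 ^ n) \<longlonglongrightarrow> x"
        proof (rule tendsto_sandwich[OF _ _ _ tendsto_const])
          have "(\<lambda>n. x - (1 / 2) ^ n) \<longlonglongrightarrow> x - 0"
            by (intro tendsto_intros LIMSEQ_power_zero) auto
          then show "(\<lambda>n. x - (1 / 2) ^ n) \<longlonglongrightarrow> x" by simp
          show "\<forall>\<^sub>F n in sequentially. x - (1 / 2) ^ n \<le> real (k n) / 2 ^ n"
            using sandwich(2) by simp
          show "\<forall>\<^sub>F n in sequentially. real (k n) / 2 ^ n \<le> x"
            using sandwich(1) by simp
        qed
        then have "(\<lambda>n. g (real (k n) / 2 ^ n)) \<longlonglongrightarrow> g x"
          using g continuous_on_tendsto_compose[of UNIV g "\<lambda>n. real (k n) / 2 ^ n" x sequentially] by simp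
        then show ?thesis
          using True s_val[OF k(2,1)] by simp
      qed (simp add: s_out)
    qed
    show "AE x in lborel. \<bar>s n x - g x * indicat_real {0..<1} x\<bar> \<le> \<bar>2 * B * indicat_real {0..<1} x\<bar>" for n
    proof (rule AE_I2)
      fix x :: real
      show "\<bar>s n x - g x * indicat_real {0..<1} x\<bar> \<le> \<bar>2 * B * indicat_real {0..<1} x\<bar>"
      proof (cases "x \<in> {0..<1}")
        case True
        then obtain k where "k < 2 ^ n" "x \<in> dyadic n k" using ex_dyadic by auto
        then show ?thesis
          using True s_val B[of x] B[of "real k / 2 ^ n"] B0 by simp
      qed (simp add: s_out)
    qed
    show "s n \<in> borel_measurable borel" for n
      using closed_span_in_Lp[OF s_span] by (rule Lp_measurable)
  qed measurable
qed (rule unit_haar_in_Lp)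

definition clamp_abs :: "real \<Rightarrow> real \<Rightarrow> real" where
  "clamp_abs M x = max (- M) (min M x)"

text \<open>A measurable function is an almost everywhere limit of continuous ones. Clamping these
  at \<open>B\<close> keeps them continuous, leaves the limit unchanged and supplies the dominating
  function.\<close>

lemma bounded_in_closed_span:
  assumes [measurable]: "f \<in> borel_measurable borel" and B: "\<And>x. \<bar>f x\<bar> \<le> B" and out: "\<And>x. x \<notin> {0..<1} \<Longrightarrow> f x = 0"
  shows "f \<in> closed_span p unit_haar"
proof -
  have B0: "0 \<le> B" using B[of 0] by linarith
  have "f \<in> borel_measurable lebesgue"
    by (intro measurable_completion) simp
  then have "f measurable_on UNIV"
    by (rule lebesgue_measurable_imp_measurable_on) simp
  then obtain N g where N: "negligible N" and g: "\<And>n. continuous_on UNIV (g n)"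
    and lim: "\<And>x. x \<notin> N \<Longrightarrow> (\<lambda>n. g n x) \<longlonglongrightarrow> f x"
    unfolding measurable_on_def by auto
  define s where "s n x = clamp_abs B (g n x) * indicat_real {0..<1} x" for n x
  have [measurable]: "g n \<in> borel_measurable borel" for n
    using g by (rule borel_measurable_continuous_onI)
  have bound_Lp: "(\<lambda>x. 2 * B * indicat_real {0..<1} x) \<in> Lp p"
    by (intro Lp_scale unit_indicator_in_Lp)
  show ?thesis
  proof (rule closed_span_lim)
    show "f \<in> Lp p"
      using B B0 order_trans[OF B, of "2 * B"] out by (intro Lp_bound[OF bound_Lp]) (auto simp: indicator_def)
    show "s n \<in> closed_span p unit_haar" for n
      unfolding s_def[abs_def] clamp_abs_def using B0
      by (intro continuous_in_closed_span[where B = B] continuous_intros g) auto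
    have "N \<in> null_sets lebesgue" using N by (simp add: negligible_iff_null_sets)
    then have "AE x in lebesgue. x \<notin> N" by (rule AE_not_in)
    then have "AE x in lborel. x \<notin> N" by (simp add: AE_completion_iff)
    then have AE: "AE x in lborel. (\<lambda>n. s n x) \<longlonglongrightarrow> f x"
    proof eventually_elim
      case (elim x)
      have "(\<lambda>n. s n x) \<longlonglongrightarrow> clamp_abs B (f x) * indicat_real {0..<1} x"
        unfolding s_def clamp_abs_def by (intro tendsto_intros tendsto_max tendsto_min lim elim)
      moreover have "clamp_abs B (f x) * indicat_real {0..<1} x = f x"
        using B[of x] out[of x] by (auto simp: clamp_abs_def indicator_def)
      ultimately show ?case by simp
    qed
    have "\<bar>s n x - f x\<bar> \<le> \<bar>2 * B * indicat_real {0..<1} x\<bar>" for n x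
      using B[of x] out[of x] B0 by (auto simp: s_def clamp_abs_def indicator_def)
    then show "(\<lambda>n. nrm (\<lambda>x. s n x - f x)) \<longlonglongrightarrow> 0"
      by (intro nrm_lim_dominated[OF bound_Lp _ _ AE]) (auto simp: s_def[abs_def] clamp_abs_def)
  qed (rule unit_haar_in_Lp)
qed

lemma unit_supported_in_closed_span:
  assumes f: "f \<in> Lp p" and out: "\<And>x. x \<notin> {0..<1} \<Longrightarrow> f x = 0"
  shows "f \<in> closed_span p unit_haar"
proof (rule closed_span_lim[OF f])
  note [measurable] = Lp_measurable[OF f]
  define s where "s n x = clamp_abs (real n) (f x)" for n x
  show "s n \<in> closed_span p unit_haar" for n
    unfolding s_def clamp_abs_def using out by (intro bounded_in_closed_span[where B = "real n"]) auto
  show "(\<lambda>n. nrm (\<lambda>x. s n x - f x)) \<longlonglongrightarrow> 0"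
  proof (rule nrm_lim_dominated[OF f])
    show "AE x in lborel. (\<lambda>n. s n x) \<longlonglongrightarrow> f x"
    proof (rule AE_I2)
      fix x :: real
      obtain n0 where "\<bar>f x\<bar> \<le> real n0" using real_arch_simple by blast
      then have "\<forall>\<^sub>F n in sequentially. s n x = f x"
        unfolding eventually_sequentially by (intro exI[of _ n0]) (auto simp: s_def clamp_abs_def)
      then show "(\<lambda>n. s n x) \<longlonglongrightarrow> f x" by (rule tendsto_eventually)
    qed
    show "AE x in lborel. \<bar>s n x - f x\<bar> \<le> \<bar>f x\<bar>" for n
      by (rule AE_I2) (auto simp: s_def clamp_abs_def)
  qed (auto simp: s_def[abs_def] clamp_abs_def)
qed (rule unit_haar_in_Lp)

section \<open>The embedding\<close>

text \<open>The isometry of \<open>Lp p\<close> onto its functions supported in the unit interval that is induced by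
  the change of variables \<open>ln (x / (1 - x))\<close>.\<close>

definition compress :: "(real \<Rightarrow> real) \<Rightarrow> real \<Rightarrow> real" where
  "compress f x = (if 0 < x \<and> x < 1
     then (1 / x + 1 / (1 - x)) powr (1 / p) * f (ln x - ln (1 - x)) else 0)"

lemma compress_linear: "compress (\<lambda>x. a * f x + b * g x) = (\<lambda>x. a * compress f x + b * compress g x)"
  by (rule ext) (simp add: compress_def algebra_simps)

lemma compress_isometry:
  assumes f: "f \<in> Lp p"
  shows "compress f \<in> Lp p" "nrm (compress f) = nrm f"
proof -
  note [measurable] = Lp_measurable[OF f]
  have [measurable]: "compress f \<in> borel_measurable borel"
    unfolding compress_def[abs_def] by measurable
  let ?S = "{0<..<1} :: real set"
  let ?g = "\<lambda>x :: real. ln x - ln (1 - x)"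
  let ?F = "\<lambda>x. \<bar>f x\<bar> powr p"
  let ?G = "\<lambda>x. \<bar>compress f x\<bar> powr p"
  have inj: "inj_on ?g ?S"
  proof (rule strict_mono_on_imp_inj_on)
    show "strict_mono_on ?S ?g"
      by (rule strict_mono_onI) (auto intro!: diff_strict_mono)
  qed
  have img: "?g ` ?S = UNIV"
  proof (intro equalityI subsetI UNIV_I)
    fix y :: real
    have pos: "0 < 1 + exp y" by (simp add: add_pos_pos)
    \<comment> \<open>The logistic function inverts the change of variables.\<close>
    define x where "x = exp y / (1 + exp y)"
    have x: "0 < x" "x < 1" "1 - x = 1 / (1 + exp y)"
      using pos by (auto simp: x_def field_simps)
    have "?g x = y"
      using pos unfolding x(3) by (simp add: x_def ln_div)
    then show "y \<in> ?g ` ?S"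
      using x by (intro image_eqI[of _ _ x]) auto
  qed
  \<comment> \<open>The weight in \<open>compress\<close> is the p-th root of the derivative of ln x
    - ln (1 - x), so its p-th power is the Jacobian.\<close>
  have G: "\<bar>1 / x + 1 / (1 - x)\<bar> * ?F (?g x) = ?G x" if "x \<in> ?S" for x
    using that p_gt_1 by (auto simp: compress_def abs_mult powr_mult powr_powr add_nonneg_nonneg)
  \<comment> \<open>The change of variables is a statement about absolute integrability over sets
    for \<open>lebesgue\<close>; the integrals pass there from \<open>lborel\<close> and
    back.\<close>
  have F_leb: "integrable lebesgue ?F" "integral\<^sup>L lebesgue ?F = integral\<^sup>L lborel ?F"
    using Lp_integrable[OF f] by (simp_all add: integrable_completion integral_completion)
  then have F_abs: "?F absolutely_integrable_on UNIV" "integral UNIV ?F = integral\<^sup>L lborel ?F"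
    using set_lebesgue_integral_eq_integral(2)[of UNIV ?F]
    by (simp_all add: set_integrable_def set_lebesgue_integral_def)
  have "(\<lambda>x. \<bar>1 / x + 1 / (1 - x)\<bar> * ?F (?g x)) absolutely_integrable_on ?S \<and>
      integral ?S (\<lambda>x. \<bar>1 / x + 1 / (1 - x)\<bar> * ?F (?g x)) = integral\<^sup>L lborel ?F"
    using F_abs
    by (subst has_absolute_integral_change_of_variables_1')
      (auto simp: img inj intro!: derivative_eq_intros)
  then have abs: "?G absolutely_integrable_on ?S" "integral ?S ?G = integral\<^sup>L lborel ?F"
    using G set_integrable_cong[of lebesgue lebesgue ?S ?S "\<lambda>x. \<bar>1 / x + 1 / (1 - x)\<bar> * ?F (?g x)" ?G]
      Henstock_Kurzweil_Integration.integral_cong[of ?S "\<lambda>x. \<bar>1 / x + 1 / (1 - x)\<bar> * ?F (?g x)" ?G] by auto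
  have ind: "(\<lambda>x. indicat_real ?S x *\<^sub>R ?G x) = ?G"
    using p_gt_1 by (auto simp: indicator_def compress_def)
  have "integrable lebesgue ?G" "integral\<^sup>L lebesgue ?G = integral\<^sup>L lborel ?F"
    using abs set_lebesgue_integral_eq_integral(2)[OF abs(1)]
    unfolding set_integrable_def set_lebesgue_integral_def ind by simp_all
  then have "integrable lborel ?G" "integral\<^sup>L lborel ?G = integral\<^sup>L lborel ?F"
    by (simp_all add: integrable_completion integral_completion)
  then show "compress f \<in> Lp p" "nrm (compress f) = nrm f"
    by (auto intro: LpI simp: Lp_norm_def)
qed

end

text \<open>The exponent is negative, so any \<open>R\<close> with R + 1 \<ge> (2^(j+3))^p
  works.\<close>

lemma ex_scale:
  assumes "1 < (p::real)"
  shows "\<exists>R>0. (real R + 1) powr (- 1 / p) \<le> 1 / 2 ^ (j + 3)"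
proof -
  define a :: real where "a = 2 ^ (j + 3)"
  obtain R0 where R0: "a powr p \<le> real R0" using real_arch_simple by blast
  define R where "R = Suc R0"
  have "0 < a" by (simp add: a_def)
  have "(real R + 1) powr (- 1 / p) \<le> (a powr p) powr (- 1 / p)"
    using R0 \<open>0 < a\<close> assms by (intro powr_mono2') (auto simp: R_def)
  also have "\<dots> = 1 / a"
    using assms \<open>0 < a\<close> by (simp add: powr_powr powr_minus_divide)
  finally show ?thesis
    by (intro exI[of _ R]) (simp add: R_def a_def)
qed

theorem theorem3p3:
  fixes p :: real
  assumes "1 < p"
  shows "\<exists>z :: nat \<Rightarrow> real \<Rightarrow> real. schauder_basic p z \<and>
           (\<forall>j. AE x in lborel. z j x \<ge> 0) \<and>
           Lp_embeds_into p (closed_span p z)"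
proof -
  interpret lp_space p using assms by unfold_locales
  have "\<forall>j. \<exists>R>0. (real R + 1) powr (- 1 / p) \<le> 1 / 2 ^ (j + 3)"
    using ex_scale[OF assms] by blast
  from choice[OF this] obtain R where R: "\<And>j. 0 < R j"
    "\<And>j. (real (R j) + 1) powr (- 1 / p) \<le> 1 / 2 ^ (j + 3)"
    by blast
  interpret tagged_system p unit_haar R
    using R unit_haar_monotone
    by unfold_locales (auto simp: nrm_unit_haar unit_haar_def haar_eq_0)
  have "compress f \<in> closed_span p system" if "f \<in> Lp p" for f
  proof (rule closed_span_trans[OF _ h_in_closed_span system_in_Lp])
    show "compress f \<in> closed_span p unit_haar"
      using compress_isometry(1)[OF that]
      by (rule unit_supported_in_closed_span) (auto simp: compress_def)
  qed
  \<comment> \<open>\<open>compress\<close> is isometric, so both constants of the embedding are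
    1.\<close>
  then have "Lp_embeds_into p (closed_span p system)"
    unfolding Lp_embeds_into_def
    by (intro exI[of _ compress] exI[of _ 1]) (auto simp: compress_linear compress_isometry(2))
  then show ?thesis
    using schauder_basic_system system_nonneg by blast
qed

end
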